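(* Let $F$ be a tract and $\varphi$ a (strong) Grassmann–Plücker function (resp. weak Grassmann–Plücker function) on a finite set $E$. Then $\mathcal C_\varphi\subseteq F^E$ satisfies the strong modular elimination axiom (C3) (resp. the weak modular elimination axiom (C3)').
   Context: A tract $F=(G,N_G)$: an abelian group $G$ (multiplicative) with $N_G\subseteq\mathbb N[G]$ satisfying (T0) $0\in N_G$; (T1) $1\notin N_G$; (T2) a unique $\epsilon\in G$ has $1+\epsilon\in N_G$; (T3) $GN_G\subseteq N_G$. $F=G\cup\{0\}$, $-x=\epsilon x$; sums in $\mathbb N[G]$ omit zeros. Support $\underline X=\{e:X(e)\ne0\}$. Grassmann–Plücker function of rank $r$: $\varphi:E^r\to F$ not identically zero, alternating (swap multiplies by $-1$; value $0$ if two arguments coincide), with $\sum_{k=1}^{r+1}(-1)^k\varphi(x_1,\dots,\hat x_k,\dots,x_{r+1})\varphi(x_k,y_1,\dots,y_{r-1})\in N_G$ for all subsets $\{x_1,\dots,x_{r+1}\}$, $\{y_1,\dots,y_{r-1}\}$ of $E$. Weak: the support of $\varphi$ is the set of bases of a rank $r$ matroid and the relation is required only when $|\{x_i\}\setminus\{y_j\}|=3$. In either case let $\underline M_\varphi$ be the matroid whose bases are the sets $\{x_1,\dots,x_r\}$ with $\varphi(x_1,\dots,x_r)\ne0$. $\mathcal C_\varphi$ is the set of $X\in F^E$ such that $\underline X$ is a circuit of $\underline M_\varphi$ and for all $e,f\in E$ and every basis $B=\{f,x_2,\dots,x_r\}$ with $\underline X\setminus e\subseteq B$, $X(f)/X(e)=-\varphi(e,x_2,\dots,x_r)/\varphi(f,x_2,\dots,x_r)$.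 For $\mathcal C\subseteq F^E$: let $U$ be the inclusion-ordered set of unions of supports of elements of $\mathcal C$ (incl. $\emptyset$); height of $A\in U$ = maximal $n$ with a chain $A_0\subsetneq\dots\subsetneq A_n=A$ in $U$; elements of $\mathcal C$ with distinct supports form a modular family of size $k$ if the union of their supports has height $k$; two form a modular pair if they form a modular family of size 2. (C3): if $X_1,\dots,X_k,X\in\mathcal C$ form a modular family of size $k+1$ with $\underline X\not\subseteq\bigcup_i\underline X_i$, and $e_i\in(\underline X\cap\underline X_i)\setminus\bigcup_{j\ne i}\underline X_j$ with $X(e_i)=-X_i(e_i)\neq0$, then there is $Z\in\mathcal C$ with $Z(e_i)=0$ for all $i$ and $X_1(f)+\dots+X_k(f)+X(f)-Z(f)\in N_G$ for all $f$. (C3)': if $X,Y\in\mathcal C$ form a modular pair and $X(e)=-Y(e)\ne0$, there is $Z\in\mathcal C$ with $Z(e)=0$ and $X(f)+Y(f)-Z(f)\in N_G$ for all $f$. *)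

theory Defs
  imports "HOL-Algebra.Group" "HOL-Library.Multiset" "HOL-Library.FuncSet"
begin

section \<open>Tracts\<close>

text \<open>
  The group semiring \<open>\<nat>[G]\<close> is rendered by finite multisets over \<open>carrier G\<close>: a multiset is the
  formal sum of its elements, the empty multiset is \<open>0\<close>, and \<open>g \<in> G\<close> acts by \<open>image_mset\<close>.
\<close>

record 'g tract = "'g monoid" +
  nullset :: "'g multiset set"

locale tract = comm_group F for F :: "('g, 'm) tract_scheme" (structure) +
  assumes nullset_carrier: "M \<in> nullset F \<Longrightarrow> set_mset M \<subseteq> carrier F"
    and T0: "{#} \<in> nullset F"
    and T1: "{#\<one>#} \<notin> nullset F"
    and T2: "\<exists>!\<epsilon>. \<epsilon> \<in> carrier F \<and> {#\<one>, \<epsilon>#} \<in> nullset F"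
    and T3: "g \<in> carrier F \<Longrightarrow> M \<in> nullset F \<Longrightarrow> image_mset (\<lambda>h. g \<otimes> h) M \<in> nullset F"

definition tract_eps :: "('g, 'm) tract_scheme \<Rightarrow> 'g" where
  "tract_eps F = (THE \<epsilon>. \<epsilon> \<in> carrier F \<and> {#\<one>\<^bsub>F\<^esub>, \<epsilon>#} \<in> nullset F)"

text \<open>
  The elements of \<open>F = G \<union> {0}\<close> have type \<open>'g option\<close>, where \<open>None\<close> is \<open>0\<close>.
\<close>

definition tract_elems :: "('g, 'm) tract_scheme \<Rightarrow> 'g option set" where
  "tract_elems F = insert None (Some ` carrier F)"

definition tneg :: "('g, 'm) tract_scheme \<Rightarrow> 'g option \<Rightarrow> 'g option" where
  "tneg F = map_option (\<lambda>x. tract_eps F \<otimes>\<^bsub>F\<^esub> x)"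

fun tmult :: "('g, 'm) tract_scheme \<Rightarrow> 'g option \<Rightarrow> 'g option \<Rightarrow> 'g option" where
  "tmult F (Some x) (Some y) = Some (x \<otimes>\<^bsub>F\<^esub> y)"
| "tmult F _ _ = None"

text \<open>
  Division by \<open>0\<close> yields \<open>0\<close>; it is only ever used below with a nonzero denominator.
\<close>

definition tdiv :: "('g, 'm) tract_scheme \<Rightarrow> 'g option \<Rightarrow> 'g option \<Rightarrow> 'g option" where
  "tdiv F x y = tmult F x (map_option (m_inv F) y)"

text \<open>
  The embedding of \<open>F\<close> into \<open>\<nat>[G]\<close>. A formal sum of elements of \<open>F\<close> is the multiset sum of
  their images, so that zeros are omitted.
\<close>

fun formal :: "'g option \<Rightarrow> 'g multiset" where
  "formal None = {#}"
| "formal (Some x) = {#x#}"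


section \<open>Matroids given by their bases\<close>

definition matroid_bases :: "'e set \<Rightarrow> 'e set set \<Rightarrow> bool" where
  "matroid_bases E \<B> \<longleftrightarrow>
     finite E \<and> \<B> \<noteq> {} \<and> (\<forall>B\<in>\<B>. B \<subseteq> E) \<and>
     (\<forall>A\<in>\<B>. \<forall>B\<in>\<B>. \<forall>a\<in>A - B. \<exists>b\<in>B - A. insert b (A - {a}) \<in> \<B>)"

definition matroid_indep :: "'e set set \<Rightarrow> 'e set \<Rightarrow> bool" where
  "matroid_indep \<B> I \<longleftrightarrow> (\<exists>B\<in>\<B>. I \<subseteq> B)"

definition matroid_circuit :: "'e set \<Rightarrow> 'e set set \<Rightarrow> 'e set \<Rightarrow> bool" where
  "matroid_circuit E \<B> C \<longleftrightarrow>
     C \<subseteq> E \<and> \<not> matroid_indep \<B> C \<and> (\<forall>D. D \<subset> C \<longrightarrow> matroid_indep \<B> D)"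


section \<open>Grassmann--Pluecker functions\<close>

text \<open>
  Elements of \<open>E\<^sup>r\<close> are lists; the values of \<open>\<phi>\<close> on other lists are irrelevant.
\<close>

definition tuples :: "'e set \<Rightarrow> nat \<Rightarrow> 'e list set" where
  "tuples E r = {xs. length xs = r \<and> set xs \<subseteq> E}"

definition alternating ::
  "('g, 'm) tract_scheme \<Rightarrow> 'e set \<Rightarrow> nat \<Rightarrow> ('e list \<Rightarrow> 'g option) \<Rightarrow> bool" where
  "alternating F E r \<phi> \<longleftrightarrow>
     (\<forall>xs\<in>tuples E r. \<forall>i<r. \<forall>j<r. i \<noteq> j \<longrightarrow>
        \<phi> (xs[i := xs ! j, j := xs ! i]) = tneg F (\<phi> xs) \<and>
        (xs ! i = xs ! j \<longrightarrow> \<phi> xs = None))"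

text \<open>
  The index \<open>k\<close> runs from \<open>0\<close> to \<open>r\<close> here, hence the sign \<open>(-1)\<^bsup>k+1\<^esup>\<close>.
\<close>

definition gp_relation ::
  "('g, 'm) tract_scheme \<Rightarrow> ('e list \<Rightarrow> 'g option) \<Rightarrow> 'e list \<Rightarrow> 'e list \<Rightarrow> bool" where
  "gp_relation F \<phi> xs ys \<longleftrightarrow>
     (\<Sum>k<length xs. formal ((tneg F ^^ Suc k)
        (tmult F (\<phi> (take k xs @ drop (Suc k) xs)) (\<phi> (xs ! k # ys))))) \<in> nullset F"

text \<open>
  The underlying matroid \<open>\<underline>M\<^sub>\<phi>\<close> is represented by its set of bases.
\<close>

definition gp_bases :: "'e set \<Rightarrow> nat \<Rightarrow> ('e list \<Rightarrow> 'g option) \<Rightarrow> 'e set set" where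
  "gp_bases E r \<phi> = {set xs | xs. xs \<in> tuples E r \<and> \<phi> xs \<noteq> None}"

text \<open>
  The relations range over the subsets \<open>{x\<^sub>1, \<dots>, x\<^sub>r\<^sub>+\<^sub>1}\<close> and \<open>{y\<^sub>1, \<dots>, y\<^sub>r\<^sub>-\<^sub>1}\<close> of \<open>E\<close>, each
  enumerated without repetition in an arbitrary order (for an alternating \<open>\<phi>\<close> the relations with
  repeated entries hold automatically). The condition \<open>Suc (length ys) = r\<close> makes them vacuous
  for \<open>r = 0\<close>.
\<close>

definition gp_function ::
  "('g, 'm) tract_scheme \<Rightarrow> 'e set \<Rightarrow> nat \<Rightarrow> ('e list \<Rightarrow> 'g option) \<Rightarrow> bool" where
  "gp_function F E r \<phi> \<longleftrightarrow>
     \<phi> \<in> tuples E r \<rightarrow> tract_elems F \<and>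
     (\<exists>xs\<in>tuples E r. \<phi> xs \<noteq> None) \<and>
     alternating F E r \<phi> \<and>
     (\<forall>xs ys. distinct xs \<and> set xs \<subseteq> E \<and> length xs = Suc r \<and>
              distinct ys \<and> set ys \<subseteq> E \<and> Suc (length ys) = r \<longrightarrow>
        gp_relation F \<phi> xs ys)"

definition weak_gp_function ::
  "('g, 'm) tract_scheme \<Rightarrow> 'e set \<Rightarrow> nat \<Rightarrow> ('e list \<Rightarrow> 'g option) \<Rightarrow> bool" where
  "weak_gp_function F E r \<phi> \<longleftrightarrow>
     \<phi> \<in> tuples E r \<rightarrow> tract_elems F \<and>
     (\<exists>xs\<in>tuples E r. \<phi> xs \<noteq> None) \<and>
     alternating F E r \<phi> \<and>
     matroid_bases E (gp_bases E r \<phi>) \<and> (\<forall>B\<in>gp_bases E r \<phi>. card B = r) \<and>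
     (\<forall>xs ys. distinct xs \<and> set xs \<subseteq> E \<and> length xs = Suc r \<and>
              distinct ys \<and> set ys \<subseteq> E \<and> Suc (length ys) = r \<and>
              card (set xs - set ys) = 3 \<longrightarrow>
        gp_relation F \<phi> xs ys)"


section \<open>The circuit set of a Grassmann--Pluecker function\<close>

definition supp :: "'e set \<Rightarrow> ('e \<Rightarrow> 'g option) \<Rightarrow> 'e set" where
  "supp E X = {e \<in> E. X e \<noteq> None}"

text \<open>
  In the displayed condition \<open>e\<close> lies in the support of \<open>X\<close> and \<open>f \<noteq> e\<close>, since a circuit is not
  contained in a basis; so both denominators are nonzero.
\<close>

definition gp_circuits ::
  "('g, 'm) tract_scheme \<Rightarrow> 'e set \<Rightarrow> nat \<Rightarrow> ('e list \<Rightarrow> 'g option) \<Rightarrow> ('e \<Rightarrow> 'g option) set"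
where
  "gp_circuits F E r \<phi> =
     {X \<in> E \<rightarrow>\<^sub>E tract_elems F.
        matroid_circuit E (gp_bases E r \<phi>) (supp E X) \<and>
        (\<forall>e\<in>E. \<forall>f\<in>E. \<forall>xs. Suc (length xs) = r \<and> set (f # xs) \<in> gp_bases E r \<phi> \<and>
            supp E X - {e} \<subseteq> set (f # xs) \<longrightarrow>
           tdiv F (X f) (X e) = tneg F (tdiv F (\<phi> (e # xs)) (\<phi> (f # xs))))}"


section \<open>Modular elimination\<close>

definition support_unions :: "'e set \<Rightarrow> ('e \<Rightarrow> 'g option) set \<Rightarrow> 'e set set" where
  "support_unions E \<C> = {\<Union> (supp E ` \<D>) | \<D>. \<D> \<subseteq> \<C>}"

text \<open>
  All elements of \<open>support_unions E \<C>\<close> are subsets of \<open>E\<close>, so for finite \<open>E\<close> the lengths of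
  chains are bounded and the maximum exists.
\<close>

definition height :: "'a set set \<Rightarrow> 'a set \<Rightarrow> nat" where
  "height U A =
     Max {n. \<exists>S :: nat \<Rightarrow> 'a set. (\<forall>i\<le>n. S i \<in> U) \<and> (\<forall>i<n. S i \<subset> S (Suc i)) \<and> S n = A}"

definition modular_family ::
  "'e set \<Rightarrow> ('e \<Rightarrow> 'g option) set \<Rightarrow> nat \<Rightarrow> ('e \<Rightarrow> 'g option) list \<Rightarrow> bool" where
  "modular_family E \<C> k Xs \<longleftrightarrow>
     length Xs = k \<and> set Xs \<subseteq> \<C> \<and> distinct (map (supp E) Xs) \<and>
     height (support_unions E \<C>) (\<Union> (supp E ` set Xs)) = k"

definition modular_pair ::
  "'e set \<Rightarrow> ('e \<Rightarrow> 'g option) set \<Rightarrow> ('e \<Rightarrow> 'g option) \<Rightarrow> ('e \<Rightarrow> 'g option) \<Rightarrow> bool" where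
  "modular_pair E \<C> X Y \<longleftrightarrow> modular_family E \<C> 2 [X, Y]"

text \<open>
  The case \<open>k = 0\<close> of strong modular elimination is trivially satisfied by \<open>Z = X\<close>.
\<close>

definition strong_modular_elimination ::
  "('g, 'm) tract_scheme \<Rightarrow> 'e set \<Rightarrow> ('e \<Rightarrow> 'g option) set \<Rightarrow> bool" where
  "strong_modular_elimination F E \<C> \<longleftrightarrow>
     (\<forall>k Xs X e. length Xs = k \<and> modular_family E \<C> (Suc k) (Xs @ [X]) \<and>
        \<not> supp E X \<subseteq> (\<Union>i<k. supp E (Xs ! i)) \<and>
        (\<forall>i<k. e i \<in> (supp E X \<inter> supp E (Xs ! i)) - (\<Union>j\<in>{..<k} - {i}. supp E (Xs ! j)) \<and>
               X (e i) = tneg F ((Xs ! i) (e i)) \<and> X (e i) \<noteq> None) \<longrightarrow>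
        (\<exists>Z\<in>\<C>. (\<forall>i<k. Z (e i) = None) \<and>
           (\<forall>f\<in>E. (\<Sum>i<k. formal ((Xs ! i) f)) + formal (X f) + formal (tneg F (Z f))
                    \<in> nullset F)))"

definition weak_modular_elimination ::
  "('g, 'm) tract_scheme \<Rightarrow> 'e set \<Rightarrow> ('e \<Rightarrow> 'g option) set \<Rightarrow> bool" where
  "weak_modular_elimination F E \<C> \<longleftrightarrow>
     (\<forall>X Y. \<forall>e\<in>E. modular_pair E \<C> X Y \<and> X e = tneg F (Y e) \<and> X e \<noteq> None \<longrightarrow>
        (\<exists>Z\<in>\<C>. Z e = None \<and>
           (\<forall>f\<in>E. formal (X f) + formal (Y f) + formal (tneg F (Z f)) \<in> nullset F)))"

end

theory Submission
  imports Defs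
begin

text \<open>
  A support \<open>C\<close> carries an element of \<open>\<C>\<^sub>\<phi>\<close>, unique up to scaling, because \<open>\<phi>(e, T) / \<phi>(f, T)\<close>
  does not depend on the choice of \<open>T \<supseteq> C - {e, f}\<close>: if two such \<open>T\<close> differ in one element, the
  three-term relation degenerates to two terms. Multiplied out, the condition defining \<open>\<C>\<^sub>\<phi>\<close> reads
  \<open>X(e) \<phi>(e, T) + X(f) \<phi>(f, T) = 0\<close>, and the Grassmann--Pluecker relation for
  \<open>supp X \<subseteq> {x\<^sub>1, \<dots>, x\<^sub>r\<^sub>+\<^sub>1}\<close> and \<open>T\<close> is a multiple of \<open>\<Sum>\<^sub>x X(x) \<phi>(x, T)\<close>.

  Let \<open>A\<close> be the union of the supports of a modular family \<open>X\<^sub>1, \<dots>, X\<^sub>k, X\<close> and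
  \<open>g \<in> supp X\<close> outside the other supports. A circuit inside
  \<open>A - {g, e\<^sub>1, \<dots>, e\<^sub>k}\<close> would extend to a chain of length \<open>k + 2\<close>, so this set is
  independent. It thus lies in a basis \<open>B\<close> for which the \<open>X\<^sub>i\<close> are fundamental circuits, and
  \<open>Z\<close> is the fundamental circuit of \<open>g\<close> with \<open>Z(g) = X(g)\<close>. For \<open>f \<in> B\<close>, the sum
  \<open>\<Sum>\<^sub>x X(x) \<phi>(x, B - f)\<close> only involves \<open>x \<in> {f, g, e\<^sub>1, \<dots>, e\<^sub>k}\<close>, and
  rewriting its terms through \<open>Z\<close> and the \<open>X\<^sub>i\<close> turns it into
  \<open>\<phi>(f, B - f) (X(f) - Z(f) + \<Sum>\<^sub>i X\<^sub>i(f))\<close>.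
\<close>

section \<open>Arithmetic in a tract\<close>

lemma tmult_None_right [simp]: "tmult F x None = None"
  by (cases x) auto

lemma tmult_eq_None_iff [simp]: "tmult F x y = None \<longleftrightarrow> x = None \<or> y = None"
  by (cases x; cases y) auto

lemma tneg_None [simp]: "tneg F None = None"
  by (simp add: tneg_def)

lemma tneg_eq_None_iff [simp]: "tneg F x = None \<longleftrightarrow> x = None"
  by (simp add: tneg_def)

lemma tneg_pow_eq_None_iff [simp]: "(tneg F ^^ n) x = None \<longleftrightarrow> x = None"
  by (induction n) auto

lemma formal_eq_empty_iff [simp]: "formal x = {#} \<longleftrightarrow> x = None"
  by (cases x) auto

lemma None_in_tract_elems [simp]: "None \<in> tract_elems F"
  by (simp add: tract_elems_def)

lemma Some_in_tract_elems_iff [simp]: "Some x \<in> tract_elems F \<longleftrightarrow> x \<in> carrier F"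
  by (auto simp: tract_elems_def)

context tract
begin

lemma eps_closed [simp]: "tract_eps F \<in> carrier F"
  and eps_null: "{#\<one>, tract_eps F#} \<in> nullset F"
  using theI'[OF T2] by (auto simp: tract_eps_def)

lemma eps_unique: "x \<in> carrier F \<Longrightarrow> {#\<one>, x#} \<in> nullset F \<Longrightarrow> x = tract_eps F"
  using T2 eps_closed eps_null by blast

text \<open>Acting on \<open>1 + eps\<close> with the inverse of \<open>eps\<close> gives
  \<open>eps^-1 + 1\<close>, so uniqueness in (T2) makes \<open>eps\<close> its own inverse.\<close>

lemma eps_eps [simp]: "tract_eps F \<otimes> tract_eps F = \<one>"
proof -
  have "{#inv (tract_eps F), \<one>#} \<in> nullset F"
    using T3[OF inv_closed[OF eps_closed] eps_null] by simp
  then have "inv (tract_eps F) = tract_eps F"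
    by (intro eps_unique) (simp_all add: add_mset_commute)
  then show ?thesis
    by (metis eps_closed r_inv)
qed

lemma tmult_closed [simp]:
  "x \<in> tract_elems F \<Longrightarrow> y \<in> tract_elems F \<Longrightarrow> tmult F x y \<in> tract_elems F"
  by (cases x; cases y) auto

lemma tneg_closed [simp]: "x \<in> tract_elems F \<Longrightarrow> tneg F x \<in> tract_elems F"
  by (cases x) (auto simp: tneg_def)

lemma tneg_tneg [simp]: "x \<in> tract_elems F \<Longrightarrow> tneg F (tneg F x) = x"
  by (cases x) (auto simp: tneg_def m_assoc[symmetric])

lemma tmult_comm:
  "x \<in> tract_elems F \<Longrightarrow> y \<in> tract_elems F \<Longrightarrow> tmult F x y = tmult F y x"
  by (cases x; cases y) (auto simp: m_comm)

lemma tmult_assoc: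
  "x \<in> tract_elems F \<Longrightarrow> y \<in> tract_elems F \<Longrightarrow> z \<in> tract_elems F \<Longrightarrow>
     tmult F (tmult F x y) z = tmult F x (tmult F y z)"
  by (cases x; cases y; cases z) (auto simp: m_assoc)

lemma tmult_lcomm:
  "x \<in> tract_elems F \<Longrightarrow> y \<in> tract_elems F \<Longrightarrow> z \<in> tract_elems F \<Longrightarrow>
     tmult F x (tmult F y z) = tmult F y (tmult F x z)"
  by (cases x; cases y; cases z) (auto simp: m_lcomm)

lemmas tmult_ac = tmult_comm tmult_assoc tmult_lcomm

lemma tmult_tneg_left [simp]:
  "x \<in> tract_elems F \<Longrightarrow> y \<in> tract_elems F \<Longrightarrow> tmult F (tneg F x) y = tneg F (tmult F x y)"
  by (cases x; cases y) (auto simp: tneg_def m_assoc)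

lemma tmult_tneg_right [simp]:
  "x \<in> tract_elems F \<Longrightarrow> y \<in> tract_elems F \<Longrightarrow> tmult F x (tneg F y) = tneg F (tmult F x y)"
  by (cases x; cases y) (auto simp: tneg_def m_lcomm)

lemma tmult_cancel:
  "z \<noteq> None \<Longrightarrow> x \<in> tract_elems F \<Longrightarrow> y \<in> tract_elems F \<Longrightarrow> z \<in> tract_elems F \<Longrightarrow>
     tmult F z x = tmult F z y \<longleftrightarrow> x = y"
  by (cases x; cases y; cases z) auto

lemma tneg_pow_closed [simp]: "x \<in> tract_elems F \<Longrightarrow> (tneg F ^^ n) x \<in> tract_elems F"
  by (induction n) auto

lemma tmult_tneg_pow_left:
  "x \<in> tract_elems F \<Longrightarrow> y \<in> tract_elems F \<Longrightarrow>
     tmult F ((tneg F ^^ n) x) y = (tneg F ^^ n) (tmult F x y)"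
  by (induction n) auto

lemma tmult_tneg_pow_right:
  "x \<in> tract_elems F \<Longrightarrow> y \<in> tract_elems F \<Longrightarrow>
     tmult F x ((tneg F ^^ n) y) = (tneg F ^^ n) (tmult F x y)"
  by (induction n) auto

lemma tneg_pow_self [simp]:
  "x \<in> tract_elems F \<Longrightarrow> (tneg F ^^ n) ((tneg F ^^ n) x) = x"
  by (induction n arbitrary: x) (auto simp: funpow_swap1)

lemma tdiv_closed [simp]:
  "x \<in> tract_elems F \<Longrightarrow> y \<in> tract_elems F \<Longrightarrow> tdiv F x y \<in> tract_elems F"
  by (cases x; cases y) (auto simp: tdiv_def)

lemma tdiv_tmult_cancel:
  "y \<noteq> None \<Longrightarrow> x \<in> tract_elems F \<Longrightarrow> y \<in> tract_elems F \<Longrightarrow> tmult F (tdiv F x y) y = x"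
  by (cases x; cases y) (auto simp: tdiv_def m_assoc)

text \<open>Clears denominators in the condition that defines \<open>gp_circuits\<close>. Both sides
  say that each quotient is the negative of the other; the numerators may be zero.\<close>

lemma tdiv_eq_tneg_tdiv_iff:
  assumes "y \<noteq> None" "w \<noteq> None"
    and [simp]: "x \<in> tract_elems F" "y \<in> tract_elems F" "v \<in> tract_elems F" "w \<in> tract_elems F"
  shows "tdiv F x y = tneg F (tdiv F v w) \<longleftrightarrow> tmult F y v = tneg F (tmult F x w)"
proof -
  define p q where "p = tdiv F x y" and "q = tdiv F v w"
  have [simp]: "p \<in> tract_elems F" "q \<in> tract_elems F"
    by (simp_all add: p_def q_def)
  have x: "x = tmult F p y" and v: "v = tmult F q w"
    using assms by (simp_all add: p_def q_def tdiv_tmult_cancel)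
  have "tmult F y v = tmult F (tmult F y w) q"
    using assms by (simp add: v tmult_ac)
  moreover have "tmult F x w = tmult F (tmult F y w) p"
    using assms by (simp add: x tmult_ac)
  ultimately have "tmult F y v = tneg F (tmult F x w) \<longleftrightarrow> q = tneg F p"
    using assms tmult_cancel[of "tmult F y w" q "tneg F p"] by simp
  then show ?thesis
    unfolding p_def[symmetric] q_def[symmetric] by auto
qed

section \<open>Null sums: scaling, one summand, two summands\<close>

lemma set_mset_formal: "x \<in> tract_elems F \<Longrightarrow> set_mset (formal x) \<subseteq> carrier F"
  by (cases x) auto

lemma image_mset_formal:
  "image_mset (\<lambda>h. c \<otimes> h) (formal x) = formal (tmult F (Some c) x)"
  by (cases x) auto

text \<open>The converse of (T3), obtained by acting with the inverse of \<open>c\<close>, which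
  undoes \<open>c\<close> on summands from the carrier.\<close>

lemma null_cancel:
  assumes "c \<in> carrier F" "set_mset M \<subseteq> carrier F" "image_mset (\<lambda>h. c \<otimes> h) M \<in> nullset F"
  shows "M \<in> nullset F"
proof -
  have "image_mset (\<lambda>h. inv c \<otimes> h) (image_mset (\<lambda>h. c \<otimes> h) M) = image_mset (\<lambda>h. h) M"
    unfolding multiset.map_comp
    by (rule image_mset_cong) (use assms in \<open>auto simp: m_assoc[symmetric]\<close>)
  with T3[OF _ assms(3), of "inv c"] assms(1) show ?thesis
    by simp
qed

lemma image_mset_sum_formal:
  "image_mset (\<lambda>h. c \<otimes> h) (\<Sum>i\<in>I. formal (x i)) = (\<Sum>i\<in>I. formal (tmult F (Some c) (x i)))"
  by (induction I rule: infinite_finite_induct) (auto simp: image_mset_formal)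

lemma set_mset_sum_formal:
  assumes "\<And>i. i \<in> I \<Longrightarrow> x i \<in> tract_elems F"
  shows "set_mset (\<Sum>i\<in>I. formal (x i)) \<subseteq> carrier F"
proof -
  have "set_mset (sum (\<lambda>i. formal (x i)) J) \<subseteq> carrier F" if "J \<subseteq> I" for J
    using that
    by (induction J rule: infinite_finite_induct) (use assms set_mset_formal in auto)
  then show ?thesis by blast
qed

lemma not_null_single:
  assumes "x \<in> tract_elems F" "formal x \<in> nullset F"
  shows "x = None"
proof (rule ccontr)
  assume "x \<noteq> None"
  then obtain c where c: "x = Some c" "c \<in> carrier F"
    using assms by (cases x) auto
  have "{#\<one>#} \<in> nullset F"
    by (rule null_cancel[of c]) (use c assms in auto)
  then show False using T1 by blast
qed

text \<open>Dividing by a nonzero \<open>x\<close> turns it into \<open>1\<close>, where (T2) leaves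
  only one partner; for \<open>x = None\<close> this is the one-summand case, which rests on
  (T1).\<close>

lemma null_pair_iff:
  assumes "x \<in> tract_elems F" "y \<in> tract_elems F"
  shows "formal x + formal y \<in> nullset F \<longleftrightarrow> y = tneg F x"
proof (cases x)
  case None
  then show ?thesis
    using not_null_single[OF assms(2)] T0 by auto
next
  case (Some c)
  with assms have c: "c \<in> carrier F" by simp
  show ?thesis
  proof
    assume *: "formal x + formal y \<in> nullset F"
    show "y = tneg F x"
    proof (cases y)
      case None
      with * Some not_null_single[OF assms(1)] show ?thesis by simp
    next
      case (Some d)
      with assms have d: "d \<in> carrier F" by simp
      have "{#\<one>, inv c \<otimes> d#} \<in> nullset F"
        by (rule null_cancel[of c])
          (use c d * Some \<open>x = Some c\<close> in \<open>auto simp: m_assoc[symmetric] add_mset_commute\<close>)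
      then have "inv c \<otimes> d = tract_eps F"
        using c d by (intro eps_unique) auto
      then have "d = tract_eps F \<otimes> c"
        using c d by (metis eps_closed inv_solve_left m_comm)
      then show ?thesis
        using Some \<open>x = Some c\<close> by (simp add: tneg_def)
    qed
  next
    assume "y = tneg F x"
    then show "formal x + formal y \<in> nullset F"
      using T3[OF c eps_null] c Some by (simp add: tneg_def m_comm add_mset_commute)
  qed
qed

end

section \<open>Bases and circuits\<close>

locale based_matroid =
  fixes E :: "'e set" and \<B> :: "'e set set" and r :: nat
  assumes bases: "matroid_bases E \<B>"
    and card_basis: "B \<in> \<B> \<Longrightarrow> card B = r"
begin

lemma finite_ground: "finite E"
  and ex_basis: "\<exists>B. B \<in> \<B>"
  and basis_subset: "B \<in> \<B> \<Longrightarrow> B \<subseteq> E"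
  and basis_exchange:
    "A \<in> \<B> \<Longrightarrow> B \<in> \<B> \<Longrightarrow> a \<in> A - B \<Longrightarrow> \<exists>b\<in>B - A. insert b (A - {a}) \<in> \<B>"
  using bases unfolding matroid_bases_def by blast+

lemma finite_basis: "B \<in> \<B> \<Longrightarrow> finite B"
  using basis_subset finite_ground finite_subset by blast

text \<open>Among the bases containing \<open>I\<close>, take one with the fewest elements outside
  \<open>I \<union> B\<close>. Exchanging such an element for one of \<open>B\<close> would keep
  \<open>I\<close> inside and lower the count.\<close>

lemma extend_to_basis:
  assumes "matroid_indep \<B> I" "B \<in> \<B>"
  shows "\<exists>B'\<in>\<B>. I \<subseteq> B' \<and> B' \<subseteq> I \<union> B"
proof -
  obtain B' where B': "B' \<in> \<B>" "I \<subseteq> B'"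
    and min: "\<And>D. D \<in> \<B> \<Longrightarrow> I \<subseteq> D \<Longrightarrow> card (B' - (I \<union> B)) \<le> card (D - (I \<union> B))"
    using ex_has_least_nat[of "\<lambda>D. D \<in> \<B> \<and> I \<subseteq> D" _ "\<lambda>D. card (D - (I \<union> B))"] assms(1)
    unfolding matroid_indep_def by metis
  have "B' \<subseteq> I \<union> B"
  proof (rule ccontr)
    assume "\<not> B' \<subseteq> I \<union> B"
    then obtain b where b: "b \<in> B'" "b \<notin> I" "b \<notin> B" by blast
    then obtain c where c: "c \<in> B - B'" "insert c (B' - {b}) \<in> \<B>"
      using basis_exchange[of B' B b] B' assms(2) by blast
    have "insert c (B' - {b}) - (I \<union> B) \<subseteq> B' - (I \<union> B)"
      using c(1) by blast
    moreover have "b \<in> B' - (I \<union> B)" "b \<notin> insert c (B' - {b})"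
      using b c(1) by auto
    ultimately have "insert c (B' - {b}) - (I \<union> B) \<subset> B' - (I \<union> B)"
      by (metis DiffD1 psubsetI)
    then have "card (insert c (B' - {b}) - (I \<union> B)) < card (B' - (I \<union> B))"
      by (intro psubset_card_mono) (use finite_basis B' in auto)
    with min[OF c(2)] b B' show False by auto
  qed
  with B' show ?thesis by blast
qed

lemma circuit_not_in_basis: "matroid_circuit E \<B> C \<Longrightarrow> B \<in> \<B> \<Longrightarrow> \<not> C \<subseteq> B"
  unfolding matroid_circuit_def matroid_indep_def by blast

lemma circuit_subset: "matroid_circuit E \<B> C \<Longrightarrow> C \<subseteq> E"
  unfolding matroid_circuit_def by blast

lemma circuit_minimal:
  "matroid_circuit E \<B> C \<Longrightarrow> matroid_circuit E \<B> D \<Longrightarrow> C \<subseteq> D \<Longrightarrow> C = D"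
  unfolding matroid_circuit_def by blast

lemma circuit_nonempty: "matroid_circuit E \<B> C \<Longrightarrow> C \<noteq> {}"
  using circuit_not_in_basis ex_basis by blast

lemma circuit_diff_indep: "matroid_circuit E \<B> C \<Longrightarrow> e \<in> C \<Longrightarrow> matroid_indep \<B> (C - {e})"
  unfolding matroid_circuit_def by blast

lemma dependent_contains_circuit:
  assumes "A \<subseteq> E" "\<not> matroid_indep \<B> A"
  shows "\<exists>C\<subseteq>A. matroid_circuit E \<B> C"
proof -
  have "finite A" using assms finite_ground finite_subset by blast
  then show ?thesis using assms
  proof (induction A rule: finite_psubset_induct)
    case (psubset A)
    show ?case
    proof (cases "matroid_circuit E \<B> A")
      case False
      then obtain D where D: "D \<subset> A" "\<not> matroid_indep \<B> D"
        using psubset.prems unfolding matroid_circuit_def by blast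
      then show ?thesis
        using psubset.IH[of D] psubset.prems by blast
    qed blast
  qed
qed

text \<open>A basis containing \<open>C - {a}\<close> and otherwise taken from \<open>B\<close>
  cannot contain \<open>a\<close>, as it would contain \<open>C\<close>. It therefore lies in
  \<open>insert e (B - {a})\<close>, and equal cardinality makes the two coincide.\<close>

lemma circuit_swap:
  assumes C: "matroid_circuit E \<B> C" and B: "B \<in> \<B>" "C \<subseteq> insert e B" and a: "a \<in> C" "a \<noteq> e"
  shows "insert e (B - {a}) \<in> \<B>"
proof -
  have e: "e \<notin> B"
    using circuit_not_in_basis[OF C B(1)] B(2) by (auto simp: insert_absorb)
  obtain B' where B': "B' \<in> \<B>" "C - {a} \<subseteq> B'" "B' \<subseteq> (C - {a}) \<union> B"
    using extend_to_basis[OF circuit_diff_indep[OF C a(1)] B(1)] by blast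
  have "a \<notin> B'"
    using circuit_not_in_basis[OF C B'(1)] B'(2) by blast
  then have sub: "B' \<subseteq> insert e (B - {a})"
    using B'(3) B(2) by blast
  moreover have "card (insert e (B - {a})) = card B'"
  proof -
    have "a \<in> B" using a B(2) by blast
    then have "card (insert e (B - {a})) = card B"
      using e finite_basis[OF B(1)] by (metis DiffD1 card_Suc_Diff1 card_insert_disjoint finite_Diff)
    then show ?thesis using card_basis B(1) B'(1) by simp
  qed
  ultimately have "B' = insert e (B - {a})"
    using finite_basis[OF B(1)] by (intro card_subset_eq) auto
  with B' show ?thesis by simp
qed

text \<open>The elements completing \<open>B - {g}\<close> to a basis form a cocircuit, which cannot meet \<open>C\<close> in
  \<open>g\<close> alone.\<close>

lemma circuit_meets_cocircuit:
  assumes C: "matroid_circuit E \<B> C" and B: "B \<in> \<B>" and g: "g \<in> C" "g \<in> B"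
  obtains b where "b \<in> C - B" "insert b (B - {g}) \<in> \<B>"
proof -
  obtain B' where B': "B' \<in> \<B>" "C - {g} \<subseteq> B'" "B' \<subseteq> (C - {g}) \<union> B"
    using extend_to_basis[OF circuit_diff_indep[OF C g(1)] B] by blast
  have "g \<in> B - B'"
    using circuit_not_in_basis[OF C B'(1)] B'(2) g by blast
  then obtain b where "b \<in> B' - B" "insert b (B - {g}) \<in> \<B>"
    using basis_exchange[OF B B'(1)] by blast
  with B'(3) show thesis by (intro that) auto
qed

end

section \<open>Alternating functions\<close>

lemma set_without_nth:
  assumes "k < length T" "x \<in> set T" "x \<noteq> T ! k"
  shows "x \<in> set (take k T @ drop (Suc k) T)"
proof -
  have "x \<in> set (take k T @ T ! k # drop (Suc k) T)"
    using assms by (simp flip: id_take_nth_drop)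
  then show ?thesis using assms(3) by auto
qed

lemma distinct_set_eq_mset:
  "distinct xs \<Longrightarrow> distinct ys \<Longrightarrow> set xs = set ys \<Longrightarrow> mset xs = mset ys"
  by (simp add: set_eq_iff_mset_eq_distinct)

locale alternating_function = tract F for F :: "('g, 'm) tract_scheme" (structure) +
  fixes E :: "'e set" and r :: nat and \<phi> :: "'e list \<Rightarrow> 'g option"
  assumes phi_closed: "\<phi> \<in> tuples E r \<rightarrow> tract_elems F"
    and phi_alternating: "alternating F E r \<phi>"
    and finite_E: "finite E"
begin

lemma phi_in [simp]: "xs \<in> tuples E r \<Longrightarrow> \<phi> xs \<in> tract_elems F"
  using phi_closed by blast

lemma phi_not_distinct:
  assumes "xs \<in> tuples E r" "\<not> distinct xs"
  shows "\<phi> xs = None"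
proof -
  obtain i j where "i < r" "j < r" "i \<noteq> j" "xs ! i = xs ! j"
    using assms by (auto simp: distinct_conv_nth tuples_def)
  then show ?thesis
    using phi_alternating assms(1) unfolding alternating_def by blast
qed

lemma phi_distinct: "xs \<in> tuples E r \<Longrightarrow> \<phi> xs \<noteq> None \<Longrightarrow> distinct xs"
  by (rule ccontr) (simp add: phi_not_distinct)

lemma phi_swap:
  assumes "us @ a # b # vs \<in> tuples E r"
  shows "\<phi> (us @ b # a # vs) = tneg F (\<phi> (us @ a # b # vs))"
proof -
  let ?xs = "us @ a # b # vs" and ?i = "length us"
  have "?i < r" "Suc ?i < r" "?i \<noteq> Suc ?i"
    using assms by (auto simp: tuples_def)
  then have "\<phi> (?xs[?i := ?xs ! Suc ?i, Suc ?i := ?xs ! ?i]) = tneg F (\<phi> ?xs)"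
    using phi_alternating assms unfolding alternating_def by blast
  moreover have "?xs ! Suc ?i = b" "?xs ! ?i = a"
    by (simp_all add: nth_append)
  moreover have "?xs[?i := b, Suc ?i := a] = us @ b # a # vs"
    by (simp add: list_update_append)
  ultimately show ?thesis by simp
qed

text \<open>Carrying \<open>a\<close> across \<open>vs\<close> takes \<open>length vs\<close>
  adjacent transpositions, each contributing a sign.\<close>

lemma phi_move:
  assumes "us @ vs @ a # ws \<in> tuples E r"
  shows "\<phi> (us @ vs @ a # ws) = (tneg F ^^ length vs) (\<phi> (us @ a # vs @ ws))"
  using assms
proof (induction vs arbitrary: us)
  case (Cons v vs)
  have "\<phi> (us @ (v # vs) @ a # ws) = (tneg F ^^ length vs) (\<phi> ((us @ [v]) @ a # vs @ ws))"
    using Cons.IH[of "us @ [v]"] Cons.prems by simp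
  also have "\<phi> ((us @ [v]) @ a # vs @ ws) = tneg F (\<phi> (us @ a # v # vs @ ws))"
    using phi_swap[of us a v "vs @ ws"] Cons.prems by (simp add: tuples_def)
  finally show ?case by (simp add: funpow_swap1)
qed simp

text \<open>The exponent \<open>s\<close> is fixed before the prefix \<open>us\<close>: one sign
  serves \<open>e # T\<close> and \<open>f # T\<close> at once, so reordering \<open>T\<close>
  leaves the ratio of these values unchanged.\<close>

lemma phi_permute:
  assumes "mset xs = mset ys" "set xs \<subseteq> E"
  shows "\<exists>s. \<forall>us. us @ xs \<in> tuples E r \<longrightarrow> \<phi> (us @ ys) = (tneg F ^^ s) (\<phi> (us @ xs))"
  using assms
proof (induction xs arbitrary: ys)
  case Nil
  then show ?case by (intro exI[of _ 0]) auto
next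
  case (Cons x xs)
  have "x \<in> set ys"
    using Cons.prems(1) by (metis list.set_intros(1) set_mset_mset)
  then obtain vs ws where ys: "ys = vs @ x # ws"
    by (meson split_list)
  have len: "length (x # xs) = length ys" and st: "set (x # xs) = set ys"
    using Cons.prems(1) by (metis size_mset, metis set_mset_mset)
  have "mset xs = mset (vs @ ws)"
    using Cons.prems(1) ys by simp
  then obtain s where s:
    "\<And>us. us @ xs \<in> tuples E r \<Longrightarrow> \<phi> (us @ vs @ ws) = (tneg F ^^ s) (\<phi> (us @ xs))"
    using Cons.IH[of "vs @ ws"] Cons.prems(2) by auto
  have "\<phi> (us @ ys) = (tneg F ^^ (length vs + s)) (\<phi> (us @ x # xs))"
    if us: "us @ x # xs \<in> tuples E r" for us
  proof -
    have "us @ ys \<in> tuples E r"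
      using us len st by (auto simp: tuples_def)
    then have "\<phi> (us @ ys) = (tneg F ^^ length vs) (\<phi> (us @ x # vs @ ws))"
      unfolding ys by (rule phi_move)
    also have "\<phi> (us @ x # vs @ ws) = (tneg F ^^ s) (\<phi> (us @ x # xs))"
      using s[of "us @ [x]"] us by simp
    finally show ?thesis by (simp add: funpow_add)
  qed
  then show ?case by blast
qed

section \<open>Bases and their enumerations\<close>

abbreviation "\<B> \<equiv> gp_bases E r \<phi>"

lemma basis_set: "xs \<in> tuples E r \<Longrightarrow> \<phi> xs \<noteq> None \<Longrightarrow> set xs \<in> \<B>"
  by (auto simp: gp_bases_def)

lemma basisE:
  assumes "B \<in> \<B>"
  obtains xs where "xs \<in> tuples E r" "\<phi> xs \<noteq> None" "set xs = B" "distinct xs"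
proof -
  from assms obtain xs where "xs \<in> tuples E r" "\<phi> xs \<noteq> None" "set xs = B"
    unfolding gp_bases_def by blast
  with phi_not_distinct[of xs] that show thesis by blast
qed

text \<open>A basis only comes with some enumeration at which \<open>\<phi>\<close> is nonzero;
  every other one without repetition is a permutation of it, which changes the value by a
  sign.\<close>

lemma phi_basis_iff:
  assumes "xs \<in> tuples E r"
  shows "\<phi> xs \<noteq> None \<longleftrightarrow> distinct xs \<and> set xs \<in> \<B>"
proof
  assume "\<phi> xs \<noteq> None"
  then show "distinct xs \<and> set xs \<in> \<B>"
    using assms phi_not_distinct[of xs] basis_set[of xs] by argo
next
  assume *: "distinct xs \<and> set xs \<in> \<B>"
  then obtain ys where ys: "ys \<in> tuples E r" "\<phi> ys \<noteq> None" "set ys = set xs" "distinct ys"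
    by (auto elim: basisE)
  with * have "mset ys = mset xs"
    by (intro distinct_set_eq_mset) auto
  then obtain s where "\<phi> xs = (tneg F ^^ s) (\<phi> ys)"
    using phi_permute[of ys xs] ys(1) by (force simp: tuples_def)
  with ys show "\<phi> xs \<noteq> None" by simp
qed

lemma phi_basis_card: "B \<in> \<B> \<Longrightarrow> card B = r"
  by (auto elim!: basisE simp: tuples_def distinct_card)

end

text \<open>Apply the relation to \<open>a\<close> followed by \<open>B\<close>, against
  \<open>A - {a}\<close>. Its first term, \<open>-\<phi>(B) \<phi>(A)\<close>, is nonzero, and a
  single nonzero term is not null, so a further term survives and yields the exchange
  element.\<close>

lemma (in alternating_function) gp_exchange:
  assumes gp: "gp_function F E r \<phi>"
  shows "matroid_bases E \<B>"
  unfolding matroid_bases_def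
proof (intro conjI ballI)
  show "finite E" by (rule finite_E)
  show "\<B> \<noteq> {}"
    using gp unfolding gp_function_def gp_bases_def by blast
  show "B \<subseteq> E" if "B \<in> \<B>" for B
    using that by (auto simp: gp_bases_def tuples_def)
  fix A B a
  assume A: "A \<in> \<B>" and B: "B \<in> \<B>" and a: "a \<in> A - B"
  obtain bs where bs: "bs \<in> tuples E r" "\<phi> bs \<noteq> None" "set bs = B" "distinct bs"
    using B by (rule basisE)
  have AE: "A \<subseteq> E" using A by (auto simp: gp_bases_def tuples_def)
  have fA: "finite A" using AE finite_E finite_subset by blast
  obtain T where T: "set T = A - {a}" "distinct T"
    using finite_distinct_list[of "A - {a}"] fA by auto
  have lenT: "Suc (length T) = r"
    using T a fA phi_basis_card[OF A] by (metis DiffD1 card.remove distinct_card)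
  have aT: "a # T \<in> tuples E r" "set (a # T) = A" "distinct (a # T)"
    using T lenT AE a by (auto simp: tuples_def)
  then have phia: "\<phi> (a # T) \<noteq> None"
    using phi_basis_iff A by metis
  define h where "h k = (tneg F ^^ Suc k)
    (tmult F (\<phi> (take k (a # bs) @ drop (Suc k) (a # bs))) (\<phi> ((a # bs) ! k # T)))" for k
  have "gp_relation F \<phi> (a # bs) T"
    using gp bs a aT lenT unfolding gp_function_def by (auto simp: tuples_def)
  then have "(\<Sum>k<Suc r. formal (h k)) \<in> nullset F"
    using bs unfolding gp_relation_def h_def[abs_def] by (simp add: tuples_def)
  then have N: "formal (h 0) + (\<Sum>k<r. formal (h (Suc k))) \<in> nullset F"
    by (simp only: sum.lessThan_Suc_shift)
  have h0: "h 0 \<in> tract_elems F" "h 0 \<noteq> None"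
    using bs aT phia by (auto simp: h_def)
  have "\<exists>k<r. h (Suc k) \<noteq> None"
  proof (rule ccontr)
    assume "\<not> ?thesis"
    then have "(\<Sum>k<r. formal (h (Suc k))) = {#}" by simp
    with N not_null_single[OF h0(1)] h0(2) show False by simp
  qed
  then obtain k where k: "k < r" "\<phi> (bs ! k # T) \<noteq> None"
    by (auto simp: h_def)
  have kB: "bs ! k \<in> B" using k bs by (auto simp: tuples_def)
  then have tup: "bs ! k # T \<in> tuples E r"
    using aT bs by (auto simp: tuples_def)
  then have "distinct (bs ! k # T)" "set (bs ! k # T) \<in> \<B>"
    using k phi_basis_iff by auto
  \<comment> \<open>Distinctness keeps \<open>bs ! k\<close> out of \<open>A - {a}\<close>, and as
    an element of \<open>B\<close> it differs from \<open>a\<close>.\<close>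
  with kB T a show "\<exists>b\<in>B - A. insert b (A - {a}) \<in> \<B>"
    by (intro bexI[of _ "bs ! k"]) auto
qed

text \<open>Places the strong case inside the locale \<open>weak_gp\<close>, whose results on
  circuits then serve both halves of the theorem.\<close>

lemma (in alternating_function) gp_function_imp_weak:
  assumes gp: "gp_function F E r \<phi>"
  shows "weak_gp_function F E r \<phi>"
  unfolding weak_gp_function_def
proof (intro conjI)
  show "\<exists>xs\<in>tuples E r. \<phi> xs \<noteq> None"
    using gp unfolding gp_function_def by (elim conjE)
  show "\<forall>xs ys. distinct xs \<and> set xs \<subseteq> E \<and> length xs = Suc r \<and>
          distinct ys \<and> set ys \<subseteq> E \<and> Suc (length ys) = r \<and> card (set xs - set ys) = 3 \<longrightarrow>
          gp_relation F \<phi> xs ys"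
    using gp unfolding gp_function_def by (elim conjE) presburger
  show "\<forall>B\<in>\<B>. card B = r"
    using phi_basis_card by (rule ballI)
qed (rule phi_closed phi_alternating gp_exchange[OF gp])+

section \<open>Circuits of a weak Grassmann--Pluecker function\<close>

locale weak_gp = alternating_function +
  assumes weak: "weak_gp_function F E r \<phi>"

sublocale weak_gp \<subseteq> based_matroid E "gp_bases E r \<phi>" r
proof
  show "matroid_bases E (gp_bases E r \<phi>)"
    using weak unfolding weak_gp_function_def by (elim conjE)
qed (rule phi_basis_card)

context weak_gp
begin

abbreviation "\<C> \<equiv> gp_circuits F E r \<phi>"

lemma three_term_relation:
  assumes "distinct xs" "set xs \<subseteq> E" "length xs = Suc r"
    and "distinct ys" "set ys \<subseteq> E" "Suc (length ys) = r" "card (set xs - set ys) = 3"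
  shows "gp_relation F \<phi> xs ys"
  using weak assms unfolding weak_gp_function_def by (elim conjE) presburger

section \<open>The ratios \<open>\<phi>(e # T) / \<phi>(f # T)\<close> along a circuit\<close>

lemma circuit_phi_None:
  "matroid_circuit E \<B> C \<Longrightarrow> C \<subseteq> set xs \<Longrightarrow> xs \<in> tuples E r \<Longrightarrow> \<phi> xs = None"
  using circuit_not_in_basis basis_set by blast

text \<open>In the relation of \<open>e # f # T\<close> against \<open>T'\<close> only the terms at
  \<open>e\<close> and \<open>f\<close> survive. Any other entry \<open>t\<close> is either in
  \<open>C\<close>, hence in \<open>T'\<close>, and the second factor repeats it, or outside
  \<open>C\<close>, and the first factor still contains all of \<open>C\<close> and
  vanishes.\<close>

lemma phi_ratio_adjacent:
  assumes C: "matroid_circuit E \<B> C" and ef: "e \<in> C" "f \<in> C" "e \<noteq> f"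
    and T: "C \<subseteq> insert e (insert f (set T))" "f # T \<in> tuples E r" "\<phi> (f # T) \<noteq> None"
    and T': "C \<subseteq> insert e (insert f (set T'))" "f # T' \<in> tuples E r" "\<phi> (f # T') \<noteq> None"
    and adj: "card (set T - set T') = 1"
  shows "tmult F (\<phi> (e # T)) (\<phi> (f # T')) = tmult F (\<phi> (e # T')) (\<phi> (f # T))"
proof -
  have eE: "e \<in> E" using C ef circuit_subset by blast
  have e: "e \<notin> set T" "e \<notin> set T'"
    using circuit_phi_None[OF C _ T(2)] circuit_phi_None[OF C _ T'(2)] T T' by auto
  have d: "distinct (f # T)" "distinct (f # T')"
    by (rule phi_distinct[OF T(2,3)], rule phi_distinct[OF T'(2,3)])
  have tup: "e # T \<in> tuples E r" "e # T' \<in> tuples E r"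
    using T(2) T'(2) eE by (auto simp: tuples_def)
  \<comment> \<open>The difference consists of \<open>e\<close>, \<open>f\<close> and the one
    element of \<open>set T - set T'\<close>, so this is one of the relations that weak functions
    satisfy.\<close>
  have "set (e # f # T) - set T' = insert e (insert f (set T - set T'))"
    using e d by auto
  moreover have "e \<notin> set T - set T'" "f \<notin> set T - set T'"
    using e d by auto
  ultimately have card: "card (set (e # f # T) - set T') = 3"
    using adj ef(3) by simp
  define h where "h k = (tneg F ^^ Suc k)
    (tmult F (\<phi> (take k (e # f # T) @ drop (Suc k) (e # f # T))) (\<phi> ((e # f # T) ! k # T')))" for k
  have "gp_relation F \<phi> (e # f # T) T'"
    by (rule three_term_relation) (use e d ef(3) T(2) T'(2) eE card in \<open>auto simp: tuples_def\<close>)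
  then have "(\<Sum>k<Suc (Suc (length T)). formal (h k)) \<in> nullset F"
    unfolding gp_relation_def h_def[abs_def] by simp
  then have N: "formal (h 0) + (formal (h (Suc 0)) + (\<Sum>k<length T. formal (h (Suc (Suc k))))) \<in> nullset F"
    by (simp only: sum.lessThan_Suc_shift)
  have "h (Suc (Suc k)) = None" if k: "k < length T" for k
  proof (cases "T ! k \<in> C")
    case True
    have "T ! k \<in> set T" using k by simp
    then have "T ! k \<in> set T'" "T ! k \<in> E"
      using True T'(1) e d T(2) by (auto simp: tuples_def)
    then have "\<phi> (T ! k # T') = None"
      using T'(2) by (intro phi_not_distinct) (auto simp: tuples_def)
    then show ?thesis by (simp add: h_def)
  next
    case False
    let ?xs = "e # f # take k T @ drop (Suc k) T"
    have "C \<subseteq> set ?xs"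
    proof
      fix x assume "x \<in> C"
      with False T(1) set_without_nth[OF k, of x] show "x \<in> set ?xs" by auto
    qed
    moreover have "?xs \<in> tuples E r"
      using k T(2) eE set_take_subset[of k T] set_drop_subset[of "Suc k" T] by (auto simp: tuples_def)
    ultimately have "\<phi> ?xs = None" by (rule circuit_phi_None[OF C])
    then show ?thesis by (simp add: h_def)
  qed
  then have "(\<Sum>k<length T. formal (h (Suc (Suc k)))) = {#}" by simp
  with N have N: "formal (h 0) + formal (h (Suc 0)) \<in> nullset F" by simp
  have h: "h 0 = tneg F (tmult F (\<phi> (f # T)) (\<phi> (e # T')))"
    "h (Suc 0) = tmult F (\<phi> (e # T)) (\<phi> (f # T'))"
    using T(2) T'(2) tup by (simp_all add: h_def)
  have "h (Suc 0) = tneg F (h 0)"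
    using N T(2) T'(2) tup by (subst (asm) null_pair_iff) (simp_all add: h)
  then show ?thesis
    using T(2) T'(2) tup by (simp add: h tmult_comm)
qed

text \<open>The bases containing a fixed independent set are connected by exchanges, so adjacent bases
  suffice.\<close>

lemma phi_ratio_independent:
  assumes C: "matroid_circuit E \<B> C" and ef: "e \<in> C" "f \<in> C" "e \<noteq> f"
    and T: "C \<subseteq> insert e (insert f (set T))" "f # T \<in> tuples E r" "\<phi> (f # T) \<noteq> None"
    and T': "C \<subseteq> insert e (insert f (set T'))" "f # T' \<in> tuples E r" "\<phi> (f # T') \<noteq> None"
  shows "tmult F (\<phi> (e # T)) (\<phi> (f # T')) = tmult F (\<phi> (e # T')) (\<phi> (f # T))"
  using T
proof (induction "card (set T - set T')" arbitrary: T rule: less_induct)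
  case less
  note T = less.prems
  have eE: "e \<in> E" using C ef circuit_subset by blast
  have d: "distinct (f # T)" "distinct (f # T')"
    by (rule phi_distinct[OF T(2,3)], rule phi_distinct[OF T'(2,3)])
  have e: "e \<notin> set T" "e \<notin> set T'"
    using circuit_phi_None[OF C _ T(2)] circuit_phi_None[OF C _ T'(2)] T T' by auto
  have tup: "e # T \<in> tuples E r" "e # T' \<in> tuples E r"
    using T(2) T'(2) eE by (auto simp: tuples_def)
  have len: "length T = length T'"
    using T(2) T'(2) by (auto simp: tuples_def)
  show ?case
  proof (cases "set T \<subseteq> set T'")
    case True
    then have "set T = set T'"
      using len d by (intro card_subset_eq) (auto simp: distinct_card)
    then have "mset T = mset T'" using d by (intro distinct_set_eq_mset) auto
    moreover have "set T \<subseteq> E" using T(2) by (auto simp: tuples_def)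
    ultimately obtain s where
      "\<And>us. us @ T \<in> tuples E r \<Longrightarrow> \<phi> (us @ T') = (tneg F ^^ s) (\<phi> (us @ T))"
      using phi_permute by blast
    from this[of "[e]"] this[of "[f]"] tup T(2) show ?thesis
      by (simp add: tmult_tneg_pow_left tmult_tneg_pow_right)
  next
    case False
    then obtain i where i: "i \<in> set T" "i \<notin> set T'" by blast
    \<comment> \<open>The exchange keeps \<open>f\<close>, which lies in both bases, and replaces
      \<open>i\<close> by an element of \<open>T'\<close>; the new tail \<open>T''\<close> is
      adjacent to \<open>T\<close> and closer to \<open>T'\<close>.\<close>
    have "set (f # T) \<in> \<B>" "set (f # T') \<in> \<B>"
      using basis_set T T' by blast+
    moreover have "i \<in> set (f # T) - set (f # T')" using i d by auto
    ultimately obtain j where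
      j: "j \<in> set (f # T') - set (f # T)" "insert j (set (f # T) - {i}) \<in> \<B>"
      using basis_exchange by meson
    have jT: "j \<in> set T'" "j \<notin> set T" "j \<noteq> f" using j by auto
    define T'' where "T'' = j # remove1 i T"
    have T''_set: "set T'' = insert j (set T - {i})"
      using d by (simp add: T''_def)
    have T''_len: "length T'' = length T"
      using i by (simp add: T''_def length_remove1) (metis Suc_pred length_pos_if_in_set)
    have T''_dist: "distinct (f # T'')"
      using jT d T''_set by (auto simp: T''_def)
    have T''_tup: "f # T'' \<in> tuples E r" "e # T'' \<in> tuples E r"
      using T''_set T''_len T(2) T'(2) jT eE by (auto simp: tuples_def)
    have "set (f # T'') = insert j (set (f # T) - {i})"
      using T''_set i d by auto
    then have T''_ne: "\<phi> (f # T'') \<noteq> None"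
      using phi_basis_iff[OF T''_tup(1)] T''_dist j(2) by simp
    have "i \<notin> C" using i T'(1) e d by auto
    then have T''_C: "C \<subseteq> insert e (insert f (set T''))"
      using T(1) T''_set by auto
    have "set T - set T'' = {i}" using i jT T''_set by auto
    then have adj: "card (set T - set T'') = 1" by simp
    have "set T'' - set T' \<subset> set T - set T'" using i jT T''_set by auto
    then have smaller: "card (set T'' - set T') < card (set T - set T')"
      by (intro psubset_card_mono) auto
    let ?q = "\<phi> (f # T'')"
    have IH: "tmult F (\<phi> (e # T'')) (\<phi> (f # T')) = tmult F (\<phi> (e # T')) ?q"
      by (rule less.hyps[OF smaller T''_C T''_tup(1) T''_ne])
    have ad: "tmult F (\<phi> (e # T)) ?q = tmult F (\<phi> (e # T'')) (\<phi> (f # T))"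
      by (rule phi_ratio_adjacent[OF C ef T T''_C T''_tup(1) T''_ne adj])
    note [simp] = T(2) T'(2) tup T''_tup
    \<comment> \<open>The intermediate value \<open>?q\<close> links the two ratio identities and is
      cancelled at the end.\<close>
    have "tmult F ?q (tmult F (\<phi> (e # T)) (\<phi> (f # T')))
        = tmult F (tmult F (\<phi> (e # T)) ?q) (\<phi> (f # T'))"
      by (simp add: tmult_ac)
    also have "\<dots> = tmult F (tmult F (\<phi> (e # T'')) (\<phi> (f # T'))) (\<phi> (f # T))"
      unfolding ad by (simp add: tmult_ac)
    also have "\<dots> = tmult F ?q (tmult F (\<phi> (e # T')) (\<phi> (f # T)))"
      unfolding IH by (simp add: tmult_ac)
    finally show ?thesis
      using T''_ne by (subst (asm) tmult_cancel) auto
  qed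
qed

text \<open>Every admissible \<open>e\<close> lies in \<open>supp E X\<close>, since otherwise the
  basis \<open>f # T\<close> would contain a circuit. Both denominators are therefore nonzero and
  the divisions can be cleared.\<close>

lemma gp_circuits_iff:
  "X \<in> \<C> \<longleftrightarrow> X \<in> E \<rightarrow>\<^sub>E tract_elems F \<and> matroid_circuit E \<B> (supp E X) \<and>
     (\<forall>e\<in>E. \<forall>f\<in>E. \<forall>T. f # T \<in> tuples E r \<and> \<phi> (f # T) \<noteq> None \<and>
        supp E X \<subseteq> insert e (insert f (set T)) \<longrightarrow>
        tmult F (X e) (\<phi> (e # T)) = tneg F (tmult F (X f) (\<phi> (f # T))))"
proof -
  have "tdiv F (X f) (X e) = tneg F (tdiv F (\<phi> (e # T)) (\<phi> (f # T))) \<longleftrightarrow>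
        tmult F (X e) (\<phi> (e # T)) = tneg F (tmult F (X f) (\<phi> (f # T)))"
    if X: "X \<in> E \<rightarrow>\<^sub>E tract_elems F" "matroid_circuit E \<B> (supp E X)"
      and T: "e \<in> E" "f \<in> E" "f # T \<in> tuples E r" "\<phi> (f # T) \<noteq> None"
        "supp E X \<subseteq> insert e (insert f (set T))" for e f T
  proof -
    have "e \<in> supp E X"
      using circuit_phi_None[OF X(2) _ T(3)] T by auto
    then show ?thesis
      using X T by (intro tdiv_eq_tneg_tdiv_iff) (auto simp: supp_def tuples_def)
  qed
  moreover have "Suc (length T) = r \<and> set (f # T) \<in> \<B> \<and> supp E X - {e} \<subseteq> set (f # T) \<longleftrightarrow>
      f # T \<in> tuples E r \<and> \<phi> (f # T) \<noteq> None \<and> supp E X \<subseteq> insert e (insert f (set T))" for e f T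
  proof -
    \<comment> \<open>A list of length \<open>r\<close> whose set is a basis has \<open>r\<close>
      distinct entries.\<close>
    have "f # T \<in> tuples E r \<and> distinct (f # T)" if "Suc (length T) = r" "set (f # T) \<in> \<B>"
      using that phi_basis_card[OF that(2)] basis_subset[OF that(2)] card_distinct[of "f # T"]
      by (simp add: tuples_def)
    moreover have "Suc (length T) = r" if "f # T \<in> tuples E r"
      using that by (simp add: tuples_def)
    moreover have "supp E X - {e} \<subseteq> set (f # T) \<longleftrightarrow> supp E X \<subseteq> insert e (insert f (set T))"
      by auto
    ultimately show ?thesis
      using phi_basis_iff[of "f # T"] by metis
  qed
  ultimately show ?thesis
    unfolding gp_circuits_def mem_Collect_eq by metis
qed

lemma
  assumes "X \<in> \<C>"
  shows gp_circuit_closed: "e \<in> E \<Longrightarrow> X e \<in> tract_elems F"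
    and gp_circuit_supp: "matroid_circuit E \<B> (supp E X)"
  using assms unfolding gp_circuits_iff by auto

lemma gp_circuit_orthogonal:
  assumes "X \<in> \<C>" "e \<in> E" "f # T \<in> tuples E r" "\<phi> (f # T) \<noteq> None"
    and "supp E X \<subseteq> insert e (insert f (set T))"
  shows "tmult F (X e) (\<phi> (e # T)) = tneg F (tmult F (X f) (\<phi> (f # T)))"
proof -
  have "f \<in> E" using assms(3) by (simp add: tuples_def)
  with assms show ?thesis unfolding gp_circuits_iff by blast
qed

text \<open>One basis containing \<open>C - {e}\<close> determines \<open>w\<close>;
  \<open>phi_ratio_independent\<close> carries the relation over to every other admissible
  \<open>T\<close>.\<close>

lemma ex_ratio:
  assumes C: "matroid_circuit E \<B> C" and ef: "e \<in> C" "f \<in> C" "e \<noteq> f" and c: "c \<in> carrier F"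
  shows "\<exists>w\<in>carrier F. \<forall>T. f # T \<in> tuples E r \<and> \<phi> (f # T) \<noteq> None \<and>
           C \<subseteq> insert e (insert f (set T)) \<longrightarrow>
           tmult F (Some c) (\<phi> (e # T)) = tneg F (tmult F (Some w) (\<phi> (f # T)))"
proof -
  have E: "e \<in> E" "f \<in> E" using C ef circuit_subset by auto
  obtain B where B: "B \<in> \<B>" "C - {e} \<subseteq> B"
    using circuit_diff_indep[OF C ef(1)] unfolding matroid_indep_def by blast
  have eB: "e \<notin> B" and fB: "f \<in> B"
    using circuit_not_in_basis[OF C B(1)] B(2) ef by auto
  obtain S where S: "set S = B - {f}" "distinct S"
    using finite_distinct_list[of "B - {f}"] finite_basis[OF B(1)] by auto
  have BE: "B \<subseteq> E" using basis_subset[OF B(1)] .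
  have len: "Suc (length S) = r"
    using S fB card_basis[OF B(1)] finite_basis[OF B(1)] by (metis card.remove distinct_card)
  have tup: "f # S \<in> tuples E r" "e # S \<in> tuples E r"
    using S len BE E by (auto simp: tuples_def)
  have "set (f # S) = B" "distinct (f # S)" using S fB by auto
  then have fS: "\<phi> (f # S) \<noteq> None" using phi_basis_iff[OF tup(1)] B(1) by simp
  \<comment> \<open>Trading \<open>f\<close> for \<open>e\<close> in \<open>B\<close> gives a basis,
    so \<open>\<phi> (e # S)\<close>, and with it \<open>w\<close>, is nonzero.\<close>
  have "set (e # S) = insert e (B - {f})" "distinct (e # S)" using S eB by auto
  moreover have "insert e (B - {f}) \<in> \<B>"
    using B(2) ef by (intro circuit_swap[OF C B(1)]) auto
  ultimately have eS: "\<phi> (e # S) \<noteq> None" using phi_basis_iff[OF tup(2)] by simp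
  have CS: "C \<subseteq> insert e (insert f (set S))" using B(2) S by auto
  define w where "w = tneg F (tdiv F (tmult F (Some c) (\<phi> (e # S))) (\<phi> (f # S)))"
  note [simp] = tup c
  have w_in [simp]: "w \<in> tract_elems F" by (simp add: w_def)
  have wS: "tmult F (Some c) (\<phi> (e # S)) = tneg F (tmult F w (\<phi> (f # S)))"
    using fS by (simp add: w_def tdiv_tmult_cancel del: tmult.simps)
  then have "w \<noteq> None" using eS by (metis option.distinct(1) tmult_eq_None_iff tneg_eq_None_iff)
  then obtain d where d: "w = Some d" "d \<in> carrier F" using w_in by (cases w) auto
  have "tmult F (Some c) (\<phi> (e # T)) = tneg F (tmult F w (\<phi> (f # T)))"
    if T: "f # T \<in> tuples E r" "\<phi> (f # T) \<noteq> None" "C \<subseteq> insert e (insert f (set T))" for T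
  proof -
    have eT: "e # T \<in> tuples E r" using T(1) E by (auto simp: tuples_def)
    note [simp] = T(1) eT
    have "tmult F (\<phi> (f # S)) (tmult F (Some c) (\<phi> (e # T)))
        = tmult F (Some c) (tmult F (\<phi> (e # T)) (\<phi> (f # S)))"
      by (simp add: tmult_ac del: tmult.simps)
    also have "\<dots> = tmult F (tmult F (Some c) (\<phi> (e # S))) (\<phi> (f # T))"
      unfolding phi_ratio_independent[OF C ef T(3) T(1,2) CS tup(1) fS]
      by (simp add: tmult_ac del: tmult.simps)
    also have "\<dots> = tmult F (\<phi> (f # S)) (tneg F (tmult F w (\<phi> (f # T))))"
      unfolding wS by (simp add: tmult_ac)
    finally show ?thesis
      using fS by (subst (asm) tmult_cancel) auto
  qed
  with d show ?thesis by blast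
qed

text \<open>Only the ratios \<open>Z(f) / Z(a)\<close> are prescribed; the remaining relations follow from these,
  applied to \<open>(a, f)\<close> and \<open>(a, e)\<close> after trading \<open>a\<close> for \<open>e\<close> in the basis \<open>f # T\<close>.\<close>

lemma ex_gp_circuit:
  assumes C: "matroid_circuit E \<B> C" and a: "a \<in> C" and c: "c \<in> carrier F"
  shows "\<exists>Z\<in>\<C>. supp E Z = C \<and> Z a = Some c"
proof -
  have CE: "C \<subseteq> E" using circuit_subset[OF C] .
  have "\<forall>f\<in>C - {a}. \<exists>w\<in>carrier F. \<forall>T. f # T \<in> tuples E r \<and> \<phi> (f # T) \<noteq> None \<and>
           C \<subseteq> insert a (insert f (set T)) \<longrightarrow>
           tmult F (Some c) (\<phi> (a # T)) = tneg F (tmult F (Some w) (\<phi> (f # T)))"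
    using ex_ratio[OF C a _ _ c] by blast
  then obtain w where w: "\<And>f. f \<in> C - {a} \<Longrightarrow> w f \<in> carrier F"
    and w_rel: "\<And>f T. f \<in> C - {a} \<Longrightarrow> f # T \<in> tuples E r \<Longrightarrow> \<phi> (f # T) \<noteq> None \<Longrightarrow>
           C \<subseteq> insert a (insert f (set T)) \<Longrightarrow>
           tmult F (Some c) (\<phi> (a # T)) = tneg F (tmult F (Some (w f)) (\<phi> (f # T)))"
    by (metis (no_types, lifting) bchoice)
  \<comment> \<open>\<open>None\<close> on \<open>E - C\<close> fixes the support, and
    \<open>undefined\<close> off \<open>E\<close> makes \<open>Z\<close> extensional.\<close>
  define Z where "Z f = (if f \<in> E then if f = a then Some c else if f \<in> C then Some (w f) else None
    else undefined)" for f
  have Z_in: "Z \<in> E \<rightarrow>\<^sub>E tract_elems F"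
    using w c by (auto simp: Z_def)
  have Z_supp: "supp E Z = C"
    using CE a by (auto simp: Z_def supp_def)
  have Za: "Z a = Some c" using a CE by (auto simp: Z_def)
  have rel: "tmult F (Z a) (\<phi> (a # T)) = tneg F (tmult F (Z f) (\<phi> (f # T)))"
    if "f \<in> C" "f \<noteq> a" "f # T \<in> tuples E r" "\<phi> (f # T) \<noteq> None" "C \<subseteq> insert a (insert f (set T))"
    for f T
  proof -
    have "Z f = Some (w f)" using that(1,2) CE by (auto simp: Z_def)
    then show ?thesis using w_rel[of f T] that Za by simp
  qed
  have "tmult F (Z e) (\<phi> (e # T)) = tneg F (tmult F (Z f) (\<phi> (f # T)))"
    if E: "e \<in> E" "f \<in> E" and T: "f # T \<in> tuples E r" "\<phi> (f # T) \<noteq> None"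
      and CT: "C \<subseteq> insert e (insert f (set T))" for e f T
  proof -
    have eC: "e \<in> C" and ef: "e \<noteq> f" and eT: "e \<notin> set T"
      using circuit_phi_None[OF C _ T(1)] T(2) CT by auto
    have d: "distinct (f # T)" and B: "set (f # T) \<in> \<B>"
      using phi_basis_iff[OF T(1)] T(2) by auto
    have tup: "e # T \<in> tuples E r" using E T(1) by (auto simp: tuples_def)
    have Z [simp]: "Z x \<in> tract_elems F" if "x \<in> E" for x using Z_in that by auto
    have swap: "insert e (set (f # T) - {x}) \<in> \<B>" if "x \<in> C" "x \<noteq> e" for x
      using CT that by (intro circuit_swap[OF C B]) auto
    \<comment> \<open>Apart from \<open>f \<notin> C\<close>, where both sides vanish, the cases ask
      whether the reference point \<open>a\<close> is \<open>e\<close>, \<open>f\<close> or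
      neither.\<close>
    consider "f \<notin> C" | "e = a" "f \<in> C" | "f = a" "e \<noteq> a" | "f \<in> C" "e \<noteq> a" "f \<noteq> a" by blast
    then show ?thesis
    proof cases
      case 1
      then have "C \<subseteq> set (e # T)" using CT by auto
      then have "\<phi> (e # T) = None" using circuit_phi_None[OF C _ tup] by blast
      moreover have "Z f = None" using 1 E a by (auto simp: Z_def)
      ultimately show ?thesis by simp
    next
      case 2
      with rel[of f T] ef T CT show ?thesis by simp
    next
      case 3
      have "set (e # T) = insert e (set (f # T) - {f})" "distinct (e # T)"
        using d eT by auto
      moreover have "insert e (set (f # T) - {f}) \<in> \<B>"
        using swap[of f] a 3 by simp
      ultimately have "\<phi> (e # T) \<noteq> None" using phi_basis_iff[OF tup] by simp
      moreover have "C \<subseteq> insert a (insert e (set T))" using CT 3 by auto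
      ultimately have "tmult F (Z a) (\<phi> (a # T)) = tneg F (tmult F (Z e) (\<phi> (e # T)))"
        using rel[of e T] eC 3 tup by simp
      then show ?thesis using 3 tup E by simp
    next
      case 4
      have aT: "a \<in> set T" using a CT 4 by auto
      define U where "U = remove1 a T"
      have mset: "mset T = mset (a # U)" using aT by (simp add: U_def)
      have U: "set U = set T - {a}" using d by (simp add: U_def)
      have TE: "set T \<subseteq> E" using T(1) by (auto simp: tuples_def)
      have len: "Suc (Suc (length U)) = r"
        using mset_eq_length[OF mset] T(1) by (simp add: tuples_def)
      have aE: "a \<in> E" using a CE by blast
      have [simp]: "x # y # U \<in> tuples E r" if "x \<in> E" "y \<in> E" for x y
        using that U TE len by (auto simp: tuples_def)
      have "set (f # e # U) = insert e (set (f # T) - {a})" using U 4 by auto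
      moreover have "distinct (f # e # U)" using d eT ef U by (auto simp: U_def)
      ultimately have q: "\<phi> (f # e # U) \<noteq> None"
        using phi_basis_iff[of "f # e # U"] swap[of a] a 4 E by simp
      have sw: "\<phi> (y # x # U) = tneg F (\<phi> (x # y # U))" if "x \<in> E" "y \<in> E" for x y
        using phi_swap[of "[]" x y U] that by simp
      have C2: "C \<subseteq> insert a (insert f (set (e # U)))" "C \<subseteq> insert a (insert e (set (f # U)))"
        using CT U by auto
      have R1: "tmult F (Z a) (\<phi> (a # e # U)) = tneg F (tmult F (Z f) (\<phi> (f # e # U)))"
        using rel[of f "e # U"] 4 q C2 E by simp
      have "\<phi> (e # f # U) \<noteq> None" using q sw[of f e] E by simp
      then have "tmult F (Z a) (\<phi> (a # f # U)) = tneg F (tmult F (Z e) (\<phi> (e # f # U)))"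
        using rel[of e "f # U"] 4 eC C2 E by simp
      then have R2: "tmult F (Z a) (\<phi> (a # f # U)) = tmult F (Z e) (\<phi> (f # e # U))"
        using sw[of f e] E by simp
      let ?q = "\<phi> (f # e # U)"
      \<comment> \<open>\<open>R1\<close> and \<open>R2\<close> both involve \<open>Z a\<close>;
        multiplying by \<open>?q\<close> allows it to be eliminated between them.\<close>
      have "tmult F ?q (tmult F (Z e) (\<phi> (a # e # U)))
          = tmult F (tmult F (Z e) ?q) (\<phi> (a # e # U))"
        using E aE by (simp add: tmult_ac)
      also have "\<dots> = tmult F (tmult F (Z a) (\<phi> (a # e # U))) (\<phi> (a # f # U))"
        unfolding R2[symmetric] using E aE by (simp add: tmult_ac)
      also have "\<dots> = tmult F ?q (tneg F (tmult F (Z f) (\<phi> (a # f # U))))"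
        unfolding R1 using E aE by (simp add: tmult_ac)
      finally have "tmult F (Z e) (\<phi> (a # e # U)) = tneg F (tmult F (Z f) (\<phi> (a # f # U)))"
        using q E aE by (subst (asm) tmult_cancel) auto
      then have aU: "tmult F (Z e) (\<phi> (e # a # U)) = tneg F (tmult F (Z f) (\<phi> (f # a # U)))"
        using sw[of a e] sw[of a f] E aE by simp
      have aUE: "set (a # U) \<subseteq> E" using aE U TE by auto
      \<comment> \<open>\<open>T\<close> is a reordering of \<open>a # U\<close>; the sign is the
        same behind \<open>e\<close> and behind \<open>f\<close>, so it drops out.\<close>
      obtain s where
        s: "\<And>us. us @ a # U \<in> tuples E r \<Longrightarrow> \<phi> (us @ T) = (tneg F ^^ s) (\<phi> (us @ a # U))"
        using phi_permute[OF mset[symmetric] aUE] by blast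
      have "\<phi> (e # T) = (tneg F ^^ s) (\<phi> (e # a # U))" "\<phi> (f # T) = (tneg F ^^ s) (\<phi> (f # a # U))"
        using s[of "[e]"] s[of "[f]"] E aE by auto
      then show ?thesis
        using aU E aE by (simp add: tmult_tneg_pow_right funpow_swap1)
    qed
  qed
  then have "Z \<in> \<C>"
    unfolding gp_circuits_iff Z_supp using Z_in C by blast
  with Z_supp Za show ?thesis by blast
qed

text \<open>Over the basis \<open>zs\<close>, which contains \<open>supp E X - {g}\<close>, the
  signed minors of \<open>g # zs\<close> are proportional to the values of \<open>X\<close>. The
  relation is thus a nonzero multiple of the sum, to which the elements outside
  \<open>g # zs\<close> contribute nothing.\<close>

lemma null_sum_of_relation:
  assumes X: "X \<in> \<C>" and g: "g \<in> supp E X" "supp E X \<subseteq> insert g (set zs)"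
    and zs: "zs \<in> tuples E r" "\<phi> zs \<noteq> None" and T: "g # T \<in> tuples E r"
    and gp: "gp_relation F \<phi> (g # zs) T"
  shows "(\<Sum>x\<in>E. formal (tmult F (X x) (\<phi> (x # T)))) \<in> nullset F"
proof -
  have gE: "g \<in> E" and Xg: "X g \<noteq> None" using g(1) by (auto simp: supp_def)
  have X_in [simp]: "X x \<in> tract_elems F" if "x \<in> E" for x
    using gp_circuit_closed[OF X that] .
  have T_in: "x # T \<in> tuples E r" if "x \<in> E" for x
    using T that by (auto simp: tuples_def)
  have zE: "set zs \<subseteq> E" and len: "length zs = r" using zs(1) by (auto simp: tuples_def)
  have g_zs: "g \<notin> set zs"
    using circuit_phi_None[OF gp_circuit_supp[OF X] _ zs(1)] zs(2) g(2) by (auto simp: insert_absorb)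
  note [simp] = gE zs(1)
  \<comment> \<open>The minor that omits \<open>g\<close> is \<open>\<phi> zs\<close> with sign -1,
    which forces this factor of proportionality.\<close>
  define c where "c = tneg F (tdiv F (\<phi> zs) (X g))"
  have c: "c \<in> tract_elems F" by (simp add: c_def)
  have cX: "tmult F c (X g) = tneg F (\<phi> zs)"
    using Xg by (simp add: c_def tdiv_tmult_cancel)
  then have "c \<noteq> None"
    using zs(2) by (metis tmult_eq_None_iff tneg_eq_None_iff)
  then obtain d where d: "c = Some d" "d \<in> carrier F" using c by (cases c) auto
  define xs where "xs = g # zs"
  have minor: "(tneg F ^^ Suc k) (\<phi> (take k xs @ drop (Suc k) xs)) = tmult F c (X (xs ! k))"
    if k: "k < Suc r" for k
  proof (cases k)
    case 0
    then show ?thesis by (simp add: xs_def cX)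
  next
    case (Suc j)
    with k len have j: "j < length zs" by simp
    define S z where "S = take j zs @ drop (Suc j) zs" and "z = zs ! j"
    have zs_eq: "zs = take j zs @ z # drop (Suc j) zs"
      using j by (simp add: z_def id_take_nth_drop[symmetric])
    have z: "z \<in> E" using j zE nth_mem by (auto simp: z_def)
    have "length S = length zs - 1" "set S \<subseteq> set zs"
      using j set_take_subset[of j zs] set_drop_subset[of "Suc j" zs] by (auto simp: S_def)
    then have S [simp]: "x # S \<in> tuples E r" if "x \<in> E" for x
      using that zE j len by (auto simp: tuples_def)
    \<comment> \<open>Bringing \<open>z\<close> to the front costs \<open>j\<close> signs, while the
      minor with index \<open>k = j + 1\<close> carries \<open>j + 2\<close>; the parities
      agree.\<close>
    have "\<phi> zs = (tneg F ^^ j) (\<phi> (z # S))"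
      using phi_move[of "[]" "take j zs" z "drop (Suc j) zs"] zs(1) zs_eq j by (simp add: S_def)
    then have zS: "\<phi> (z # S) = (tneg F ^^ j) (\<phi> zs)" using z by simp
    have "supp E X \<subseteq> insert g (insert z (set S))"
    proof -
      have "set zs \<subseteq> insert z (set S)" by (subst zs_eq) (auto simp: S_def)
      with g(2) show ?thesis by blast
    qed
    then have "tmult F (X g) (\<phi> (g # S)) = tneg F (tmult F (X z) (\<phi> (z # S)))"
      using z zS zs(2) by (intro gp_circuit_orthogonal[OF X]) auto
    then have "tmult F (X g) ((tneg F ^^ Suc k) (\<phi> (g # S))) = tneg F (tmult F (X z) (\<phi> zs))"
      unfolding zS using z Suc by (simp add: tmult_tneg_pow_right funpow_swap1)
    also have "\<dots> = tmult F (X g) (tmult F c (X z))"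
    proof -
      have "tmult F (X g) (tmult F c (X z)) = tmult F (X z) (tmult F c (X g))"
        using z c by (simp add: tmult_ac)
      then show ?thesis unfolding cX using z by simp
    qed
    finally have "(tneg F ^^ Suc k) (\<phi> (g # S)) = tmult F c (X z)"
      using Xg z c by (subst (asm) tmult_cancel) auto
    then show ?thesis using Suc by (simp add: xs_def S_def z_def)
  qed
  have nth_E: "xs ! k \<in> E" if "k < Suc r" for k
    using that zE len nth_mem[of k xs] by (auto simp: xs_def)
  let ?h = "\<lambda>x. tmult F (X x) (\<phi> (x # T))"
  have h_in: "?h x \<in> tract_elems F" if "x \<in> E" for x
    using that T_in by simp
  have minor_in: "take k xs @ drop (Suc k) xs \<in> tuples E r" if "k < Suc r" for k
    using that len zE set_take_subset[of k xs] set_drop_subset[of "Suc k" xs]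
    by (auto simp: tuples_def xs_def)
  have "(\<Sum>k<Suc r. formal ((tneg F ^^ Suc k)
      (tmult F (\<phi> (take k xs @ drop (Suc k) xs)) (\<phi> (xs ! k # T))))) \<in> nullset F"
    using gp len unfolding gp_relation_def xs_def by simp
  also have "(\<Sum>k<Suc r. formal ((tneg F ^^ Suc k)
      (tmult F (\<phi> (take k xs @ drop (Suc k) xs)) (\<phi> (xs ! k # T))))) =
      (\<Sum>k<Suc r. formal (tmult F (Some d) (?h (xs ! k))))"
  proof (rule sum.cong[OF refl])
    fix k assume "k \<in> {..<Suc r}"
    then have k: "k < Suc r" by simp
    have "(tneg F ^^ Suc k) (tmult F (\<phi> (take k xs @ drop (Suc k) xs)) (\<phi> (xs ! k # T)))
        = tmult F ((tneg F ^^ Suc k) (\<phi> (take k xs @ drop (Suc k) xs))) (\<phi> (xs ! k # T))"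
      using minor_in[OF k] T_in[OF nth_E[OF k]] by (intro tmult_tneg_pow_left[symmetric] phi_in)
    also have "\<dots> = tmult F c (?h (xs ! k))"
      unfolding minor[OF k] using c T_in[OF nth_E[OF k]] nth_E[OF k] by (simp add: tmult_assoc)
    finally show "formal ((tneg F ^^ Suc k)
        (tmult F (\<phi> (take k xs @ drop (Suc k) xs)) (\<phi> (xs ! k # T)))) =
        formal (tmult F (Some d) (?h (xs ! k)))"
      unfolding d(1) by (rule arg_cong)
  qed
  also have "\<dots> = (\<Sum>x\<in>set xs. formal (tmult F (Some d) (?h x)))"
  proof (rule sum.reindex_bij_betw)
    show "bij_betw (\<lambda>k. xs ! k) {..<Suc r} (set xs)"
      using g_zs len phi_distinct[OF zs] by (intro bij_betw_nth) (auto simp: xs_def)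
  qed
  also have "\<dots> = image_mset (\<lambda>h. d \<otimes> h) (\<Sum>x\<in>set xs. formal (?h x))"
    by (rule image_mset_sum_formal[symmetric])
  finally have "image_mset (\<lambda>h. d \<otimes> h) (\<Sum>x\<in>set xs. formal (?h x)) \<in> nullset F" .
  moreover have xsE: "set xs \<subseteq> E" using zE gE by (simp add: xs_def)
  then have "set_mset (\<Sum>x\<in>set xs. formal (?h x)) \<subseteq> carrier F"
    by (intro set_mset_sum_formal h_in) (rule subsetD)
  ultimately have "(\<Sum>x\<in>set xs. formal (?h x)) \<in> nullset F"
    using null_cancel[OF d(2)] by blast
  also have "(\<Sum>x\<in>set xs. formal (?h x)) = (\<Sum>x\<in>E. formal (?h x))"
  proof (rule sum.mono_neutral_left[OF finite_E xsE])
    show "\<forall>x\<in>E - set xs. formal (?h x) = {#}"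
      using g(2) by (auto simp: xs_def supp_def)
  qed
  finally show ?thesis .
qed

end

section \<open>Modular elimination\<close>

text \<open>The \<open>i\<close>-th member of a chain has at least \<open>i\<close> elements, so
  chains ending in \<open>A\<close> have length at most \<open>card A\<close>. The maximum in
  \<open>height\<close> is then taken over a finite set and bounds each of its members.\<close>

lemma height_ge:
  assumes "finite A" "\<And>i. i \<le> n \<Longrightarrow> S i \<in> U" "\<And>i. i < n \<Longrightarrow> S i \<subset> S (Suc i)" "S n = A"
  shows "n \<le> height U A"
proof -
  let ?N = "{n. \<exists>S. (\<forall>i\<le>n. S i \<in> U) \<and> (\<forall>i<n. S i \<subset> S (Suc i)) \<and> S n = A}"
  have "m \<le> card A" if m: "m \<in> ?N" for m
  proof -
    obtain S where S: "\<forall>i<m. S i \<subset> S (Suc i)" "S m = A"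
      using m by blast
    have sub: "S i \<subseteq> A" if "i \<le> m" for i
      using that
    proof (induction i rule: inc_induct)
      case (step i)
      then have "S i \<subset> S (Suc i)" using S(1) by simp
      with step.IH show ?case by (meson psubset_imp_subset subset_trans)
    qed (use S(2) in simp)
    have "i \<le> card (S i)" if "i \<le> m" for i
      using that
    proof (induction i)
      case (Suc i)
      have "card (S i) < card (S (Suc i))"
      proof (rule psubset_card_mono)
        show "finite (S (Suc i))" using sub[OF Suc.prems] assms(1) finite_subset by blast
        show "S i \<subset> S (Suc i)" using S(1) Suc.prems by simp
      qed
      with Suc show ?case by simp
    qed simp
    from this[of m] S(2) show ?thesis by simp
  qed
  then have "finite ?N" by (meson finite_nat_set_iff_bounded_le)
  moreover have "n \<in> ?N"
    by (intro CollectI exI[of _ S] conjI allI impI assms(2-4))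
  ultimately show ?thesis unfolding height_def by (rule Max_ge)
qed

context weak_gp
begin

section \<open>Modular families with an element \<open>g\<close> private to
  \<open>supp E X\<close>\<close>

context
  fixes Xs X e g and k :: nat
  assumes len: "length Xs = k"
    and family: "modular_family E \<C> (Suc k) (Xs @ [X])"
    and g: "g \<in> supp E X" "\<And>i. i < k \<Longrightarrow> g \<notin> supp E (Xs ! i)"
    and e: "\<And>i. i < k \<Longrightarrow> e i \<in> supp E X" "\<And>i. i < k \<Longrightarrow> e i \<in> supp E (Xs ! i)"
      "\<And>i j. i < k \<Longrightarrow> j < k \<Longrightarrow> j \<noteq> i \<Longrightarrow> e i \<notin> supp E (Xs ! j)"
begin

lemma Xs_in: "i < k \<Longrightarrow> Xs ! i \<in> \<C>"
  and X_in: "X \<in> \<C>"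
  using family len by (auto simp: modular_family_def)

lemma family_diff_indep:
  "matroid_indep \<B> ((supp E X \<union> (\<Union>i<k. supp E (Xs ! i))) - insert g (e ` {..<k}))"
    (is "matroid_indep \<B> (?A - ?R)")
proof (rule ccontr)
  assume dep: "\<not> matroid_indep \<B> (?A - ?R)"
  have AE: "?A \<subseteq> E" by (auto simp: supp_def)
  then obtain D where D: "D \<subseteq> ?A - ?R" "matroid_circuit E \<B> D"
    using dependent_contains_circuit[OF _ dep] by blast
  then obtain a where "a \<in> D" using circuit_nonempty by blast
  \<comment> \<open>Heights are measured in unions of supports, so \<open>D\<close> has to be
    realised as the support of an element of \<open>\<C>\<close>.\<close>
  then obtain W where W: "W \<in> \<C>" "supp E W = D"
    using ex_gp_circuit[OF D(2) _ one_closed] by blast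
  have Xs_set: "set Xs = (\<lambda>i. Xs ! i) ` {..<k}"
    using len by (auto simp: set_conv_nth)
  \<comment> \<open>The chain runs through the empty set, the unions of \<open>D\<close> with the
    first \<open>m\<close> supports for \<open>m \<le> k\<close>, and finally \<open>?A\<close>.
    Adding support \<open>m\<close> brings in \<open>e m\<close>, and the last step brings in
    \<open>g\<close>; the length \<open>k + 2\<close> exceeds the height
    \<open>k + 1\<close>.\<close>
  define S where "S n = (if n = 0 then {} else if n = Suc (Suc k) then ?A
    else D \<union> (\<Union>i<n - 1. supp E (Xs ! i)))" for n
  have "Suc (Suc k) \<le> height (support_unions E \<C>) ?A"
  proof (rule height_ge[where S = S])
    show "finite ?A" using AE finite_E finite_subset by blast
    show "S (Suc (Suc k)) = ?A" by (simp add: S_def)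
    show "S n \<in> support_unions E \<C>" if n: "n \<le> Suc (Suc k)" for n
    proof -
      have U: "\<Union> (supp E ` \<D>) \<in> support_unions E \<C>" if "\<D> \<subseteq> \<C>" for \<D>
        using that unfolding support_unions_def by blast
      consider "n = 0" | "n = Suc (Suc k)" | m where "n = Suc m" "m \<le> k"
        using n by (cases n) (auto simp: le_Suc_eq)
      then show ?thesis
      proof cases
        case 1
        then show ?thesis using U[of "{}"] by (simp add: S_def)
      next
        case 2
        have "insert X ((\<lambda>i. Xs ! i) ` {..<k}) \<subseteq> \<C>" using Xs_in X_in by auto
        from U[OF this] 2 show ?thesis by (simp add: S_def)
      next
        case 3
        have "insert W ((\<lambda>i. Xs ! i) ` {..<m}) \<subseteq> \<C>" using Xs_in W 3 by auto
        from U[OF this] 3 W show ?thesis by (simp add: S_def)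
      qed
    qed
    show "S n \<subset> S (Suc n)" if n: "n < Suc (Suc k)" for n
    proof -
      consider "n = 0" | "n = Suc k" | m where "n = Suc m" "m < k"
        using n by (cases n) (auto simp: less_Suc_eq)
      then show ?thesis
      proof cases
        case 1
        then show ?thesis using \<open>a \<in> D\<close> by (auto simp: S_def)
      next
        case 2
        have "g \<in> ?A" "g \<notin> D \<union> (\<Union>i<k. supp E (Xs ! i))" using D(1) g by auto
        with 2 D(1) show ?thesis by (auto simp: S_def)
      next
        case 3
        have "e m \<notin> D" using D(1) 3 by auto
        then have "e m \<notin> D \<union> (\<Union>i<m. supp E (Xs ! i))" "e m \<in> supp E (Xs ! m)"
          using e(2,3) 3 by auto
        with 3 show ?thesis by (auto simp: S_def lessThan_Suc)
      qed
    qed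
  qed
  moreover have "\<Union> (supp E ` set (Xs @ [X])) = ?A"
    using Xs_set by auto
  ultimately show False
    using family unfolding modular_family_def by simp
qed

text \<open>No basis containing the independent set of \<open>family_diff_indep\<close> contains an
  \<open>e i\<close>, since it would contain the whole support of \<open>Xs ! i\<close>. The same
  fact makes that set together with \<open>g\<close> dependent, which yields
  \<open>D\<close>.\<close>

lemma family_basis:
  obtains B D where "B \<in> \<B>" "g \<notin> B" "supp E X \<subseteq> insert g (B \<union> e ` {..<k})"
    and "\<And>i. i < k \<Longrightarrow> e i \<notin> B" "\<And>i. i < k \<Longrightarrow> supp E (Xs ! i) \<subseteq> insert (e i) B"
    and "matroid_circuit E \<B> D" "g \<in> D" "D \<subseteq> insert g B" "\<And>i. i < k \<Longrightarrow> e i \<notin> D"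
proof -
  define A where "A = (supp E X \<union> (\<Union>i<k. supp E (Xs ! i))) - insert g (e ` {..<k})"
  have A_indep: "matroid_indep \<B> A" using family_diff_indep by (simp add: A_def)
  have supp_Xs: "supp E (Xs ! i) \<subseteq> insert (e i) A" if i: "i < k" for i
  proof
    fix x assume x: "x \<in> supp E (Xs ! i)"
    then have "x \<noteq> g" using g(2) i by auto
    moreover have "x \<noteq> e j" if "j < k" "j \<noteq> i" for j using e(3)[OF that(1) i] that x by auto
    ultimately show "x \<in> insert (e i) A" using x i by (auto simp: A_def)
  qed
  have supp_X: "supp E X \<subseteq> insert g (A \<union> e ` {..<k})" by (auto simp: A_def)
  have e_notin: "e i \<notin> B" if "i < k" "B \<in> \<B>" "A \<subseteq> B" for i B
    using circuit_not_in_basis[OF gp_circuit_supp[OF Xs_in[OF that(1)]] that(2)]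
      supp_Xs[OF that(1)] that by (auto simp: insert_absorb)
  have "\<not> matroid_indep \<B> (insert g A)"
  proof
    assume "matroid_indep \<B> (insert g A)"
    then obtain B where B: "B \<in> \<B>" "insert g A \<subseteq> B" unfolding matroid_indep_def by blast
    \<comment> \<open>Such a basis could trade \<open>g\<close> for another element of
      \<open>supp E X\<close>. That element is some \<open>e i\<close>, and the new basis still
      contains \<open>A\<close>.\<close>
    then obtain b where b: "b \<in> supp E X - B" "insert b (B - {g}) \<in> \<B>"
      using circuit_meets_cocircuit[OF gp_circuit_supp[OF X_in] B(1) g(1)] by blast
    then have "b \<in> e ` {..<k}" using supp_X B(2) by auto
    then obtain i where i: "i < k" "b = e i" by auto
    have "A \<subseteq> insert b (B - {g})" using B(2) by (auto simp: A_def)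
    then show False using e_notin[OF i(1) b(2)] i(2) by simp
  qed
  moreover have gE: "insert g A \<subseteq> E" using g(1) by (auto simp: A_def supp_def)
  ultimately obtain D where D: "D \<subseteq> insert g A" "matroid_circuit E \<B> D"
    using dependent_contains_circuit[of "insert g A"] by meson
  obtain B where B: "B \<in> \<B>" "A \<subseteq> B" using A_indep unfolding matroid_indep_def by blast
  have gD: "g \<in> D" using circuit_not_in_basis[OF D(2) B(1)] D(1) B(2) by auto
  have gB: "g \<notin> B" using circuit_not_in_basis[OF D(2) B(1)] D(1) B(2) by auto
  have eD: "e i \<notin> D" if "i < k" for i
  proof -
    have "e i \<noteq> g" using e(2) g(2) that by auto
    then show ?thesis using D(1) e_notin[OF that B] B(2) by auto
  qed
  show thesis
  proof (rule that[OF B(1) gB _ _ _ D(2) gD _ eD])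
    show "supp E X \<subseteq> insert g (B \<union> e ` {..<k})" using supp_X B(2) by blast
    show "e i \<notin> B" if "i < k" for i by (rule e_notin[OF that B])
    show "supp E (Xs ! i) \<subseteq> insert (e i) B" if "i < k" for i using supp_Xs[OF that] B(2) by blast
    show "D \<subseteq> insert g B" using D(1) B(2) by blast
  qed
qed

text \<open>The hypothesis \<open>null\<close> is where strong and weak functions part: each derives
  this sum from the relations at its disposal, and may use what \<open>family_basis\<close> provides
  about \<open>B\<close>.\<close>

lemma modular_elimination:
  assumes neg: "\<And>i. i < k \<Longrightarrow> X (e i) = tneg F ((Xs ! i) (e i))"
    and null: "\<And>B f T. B \<in> \<B> \<Longrightarrow> g \<notin> B \<Longrightarrow> supp E X \<subseteq> insert g (B \<union> e ` {..<k}) \<Longrightarrow>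
      (\<And>i. i < k \<Longrightarrow> e i \<notin> B \<and> supp E (Xs ! i) \<subseteq> insert (e i) B) \<Longrightarrow>
      set (f # T) = B \<Longrightarrow> f # T \<in> tuples E r \<Longrightarrow> \<phi> (f # T) \<noteq> None \<Longrightarrow>
      (\<Sum>x\<in>E. formal (tmult F (X x) (\<phi> (x # T)))) \<in> nullset F"
  shows "\<exists>Z\<in>\<C>. (\<forall>i<k. Z (e i) = None) \<and>
      (\<forall>f\<in>E. (\<Sum>i<k. formal ((Xs ! i) f)) + formal (X f) + formal (tneg F (Z f)) \<in> nullset F)"
proof -
  obtain B D where B: "B \<in> \<B>" "g \<notin> B" and X_B: "supp E X \<subseteq> insert g (B \<union> e ` {..<k})"
    and eB: "\<And>i. i < k \<Longrightarrow> e i \<notin> B" and Xs_B: "\<And>i. i < k \<Longrightarrow> supp E (Xs ! i) \<subseteq> insert (e i) B"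
    and D: "matroid_circuit E \<B> D" "g \<in> D" "D \<subseteq> insert g B" "\<And>i. i < k \<Longrightarrow> e i \<notin> D"
    by (rule family_basis) blast
  have gE: "g \<in> E" and "X g \<noteq> None" using g(1) by (auto simp: supp_def)
  moreover have X_cl [simp]: "X x \<in> tract_elems F" if "x \<in> E" for x
    using gp_circuit_closed[OF X_in that] .
  ultimately obtain c where c: "X g = Some c" "c \<in> carrier F"
    by (metis Some_in_tract_elems_iff not_None_eq)
  obtain Z where Z: "Z \<in> \<C>" "supp E Z = D" "Z g = X g"
    using ex_gp_circuit[OF D(1,2) c(2)] c(1) by auto
  have Z_cl [simp]: "Z x \<in> tract_elems F" if "x \<in> E" for x
    using gp_circuit_closed[OF Z(1) that] .
  have Xs_cl [simp]: "(Xs ! i) x \<in> tract_elems F" if "i < k" "x \<in> E" for i x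
    using gp_circuit_closed[OF Xs_in that(2)] that(1) .
  have eE: "e i \<in> E" if "i < k" for i using e(1)[OF that] by (auto simp: supp_def)
  have eg: "e i \<noteq> g" if "i < k" for i using e(2) g(2) that by auto
  have e_inj: "inj_on e {..<k}"
    by (rule inj_onI) (use e(2,3) in fastforce)
  have Z_None: "Z x = None" if "x \<in> E" "x \<notin> D" for x
    using that Z(2) by (auto simp: supp_def)
  have X_None: "X x = None" if "x \<in> E" "x \<notin> supp E X" for x
    using that by (auto simp: supp_def)
  have Xs_None: "(Xs ! i) x = None" if "i < k" "x \<in> E" "x \<noteq> e i" "x \<notin> B" for i x
    using that Xs_B[OF that(1)] by (auto simp: supp_def)
  have "(\<Sum>i<k. formal ((Xs ! i) f)) + formal (X f) + formal (tneg F (Z f)) \<in> nullset F"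
    if fE: "f \<in> E" for f
  proof -
    \<comment> \<open>At \<open>g\<close> only \<open>X\<close> and \<open>Z\<close> contribute, at
      \<open>e j\<close> only \<open>X\<close> and \<open>Xs ! j\<close>, and outside these and
      \<open>B\<close> nothing does. The case \<open>f \<in> B\<close> is where \<open>null\<close>
      enters.\<close>
    consider "f = g" | j where "j < k" "f = e j" | "f \<in> B"
      | "f \<noteq> g" "f \<notin> e ` {..<k}" "f \<notin> B" by blast
    then show ?thesis
    proof cases
      case 1
      have "(\<Sum>i<k. formal ((Xs ! i) f)) = {#}"
        using 1 eg Xs_None gE B(2) by (intro sum.neutral) fastforce
      moreover have "formal (X g) + formal (tneg F (X g)) \<in> nullset F"
        using gE by (subst null_pair_iff) auto
      ultimately show ?thesis using 1 Z(3) by simp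
    next
      case 2
      have "(\<Sum>i<k. formal ((Xs ! i) f)) = (\<Sum>i\<in>{j}. formal ((Xs ! i) f))"
      proof (rule sum.mono_neutral_right)
        show "\<forall>i\<in>{..<k} - {j}. formal ((Xs ! i) f) = {#}"
          using e(3)[OF 2(1)] 2 fE by (auto simp: supp_def)
      qed (use 2 in auto)
      moreover have "formal ((Xs ! j) f) + formal (X f) \<in> nullset F"
        using 2 fE neg[OF 2(1)] by (subst null_pair_iff) auto
      ultimately show ?thesis using Z_None[OF fE] D(4) 2 by simp
    next
      case 4
      then have "f \<notin> D" "f \<notin> supp E X" using D(3) X_B by auto
      moreover have "(\<Sum>i<k. formal ((Xs ! i) f)) = {#}"
        using 4 Xs_None fE by (intro sum.neutral) auto
      ultimately show ?thesis using Z_None X_None fE T0 by simp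
    next
      case 3
      obtain T where T: "set T = B - {f}" "distinct T"
        using finite_distinct_list[of "B - {f}"] finite_basis[OF B(1)] by auto
      have fT_set: "set (f # T) = B" and fT_dist: "distinct (f # T)" using T 3 by auto
      have "length (f # T) = r"
        using card_basis[OF B(1)] distinct_card[OF fT_dist] fT_set by simp
      then have tup [simp]: "x # T \<in> tuples E r" if "x \<in> E" for x
        using that T basis_subset[OF B(1)] by (auto simp: tuples_def)
      have ne: "\<phi> (f # T) \<noteq> None"
        using phi_basis_iff[OF tup[OF fE]] fT_set fT_dist B(1) by simp
      let ?h = "\<lambda>x. tmult F (X x) (\<phi> (x # T))"
      let ?p = "\<phi> (f # T)"
      have N: "(\<Sum>x\<in>E. formal (?h x)) \<in> nullset F"
        using null[OF B X_B _ fT_set tup[OF fE] ne] eB Xs_B by blast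
      \<comment> \<open>Any other \<open>x\<close> in \<open>supp E X\<close> lies in
        \<open>B - {f}\<close> and repeats an entry of \<open>T\<close>.\<close>
      have "(\<Sum>x\<in>E. formal (?h x)) = (\<Sum>x\<in>insert f (insert g (e ` {..<k})). formal (?h x))"
      proof (rule sum.mono_neutral_right[OF finite_E])
        show "\<forall>x\<in>E - insert f (insert g (e ` {..<k})). formal (?h x) = {#}"
        proof
          fix x assume x: "x \<in> E - insert f (insert g (e ` {..<k}))"
          show "formal (?h x) = {#}"
          proof (cases "x \<in> supp E X")
            case True
            then have "x \<in> set T" using x X_B T by auto
            then have "\<phi> (x # T) = None" using x by (intro phi_not_distinct) auto
            then show ?thesis by simp
          next
            case False
            then have "X x = None" using x X_None by blast
            then show ?thesis by simp
          qed
        qed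
        show "insert f (insert g (e ` {..<k})) \<subseteq> E" using fE gE eE by blast
      qed
      also have "\<dots> = formal (?h f) + (formal (?h g) + (\<Sum>i<k. formal (?h (e i))))"
      proof -
        have "f \<noteq> g" "f \<notin> e ` {..<k}" "g \<notin> e ` {..<k}" using 3 B(2) eB eg by auto
        then show ?thesis using e_inj by (simp add: sum.reindex)
      qed
      \<comment> \<open>This is the circuit relation of \<open>Z\<close> at \<open>g\<close> and
        \<open>f\<close>, read with \<open>Z g = X g\<close>.\<close>
      also have "?h g = tmult F ?p (tneg F (Z f))"
      proof -
        have "?h g = tneg F (tmult F (Z f) ?p)"
          using gp_circuit_orthogonal[OF Z(1) gE tup[OF fE] ne] Z(2,3) D(3) T by auto
        then show ?thesis using fE by (simp add: tmult_comm)
      qed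
      \<comment> \<open>The sign in the circuit relation of \<open>Xs ! i\<close> at
        \<open>e i\<close> and \<open>f\<close> cancels the one in \<open>neg\<close>.\<close>
      also have "(\<Sum>i<k. formal (?h (e i))) = (\<Sum>i<k. formal (tmult F ?p ((Xs ! i) f)))"
      proof (rule sum.cong[OF refl])
        fix i assume "i \<in> {..<k}"
        then have i: "i < k" by simp
        have "tmult F ((Xs ! i) (e i)) (\<phi> (e i # T)) = tneg F (tmult F ((Xs ! i) f) ?p)"
          using gp_circuit_orthogonal[OF Xs_in[OF i] eE[OF i] tup[OF fE] ne] Xs_B[OF i] T by auto
        then have "?h (e i) = tmult F ?p ((Xs ! i) f)"
          using i fE eE neg by (simp add: tmult_comm)
        then show "formal (?h (e i)) = formal (tmult F ?p ((Xs ! i) f))" by (rule arg_cong)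
      qed
      also have "?h f = tmult F ?p (X f)"
        using fE by (simp add: tmult_comm)
      finally have eq: "(\<Sum>x\<in>E. formal (?h x)) = formal (tmult F ?p (X f)) +
        (formal (tmult F ?p (tneg F (Z f))) + (\<Sum>i<k. formal (tmult F ?p ((Xs ! i) f))))" .
      obtain p where p: "?p = Some p" "p \<in> carrier F"
        using ne phi_in[OF tup[OF fE]] by (cases ?p) auto
      let ?M = "(\<Sum>i<k. formal ((Xs ! i) f)) + formal (X f) + formal (tneg F (Z f))"
      have "image_mset (\<lambda>h. p \<otimes> h) ?M = (\<Sum>x\<in>E. formal (?h x))"
        unfolding eq p(1) by (simp only: image_mset_union image_mset_sum_formal image_mset_formal ac_simps)
      with N have "image_mset (\<lambda>h. p \<otimes> h) ?M \<in> nullset F" by simp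
      moreover note null_cancel[OF p(2), of ?M]
      moreover have "set_mset ?M \<subseteq> carrier F"
        using set_mset_sum_formal[of "{..<k}" "\<lambda>i. (Xs ! i) f"] fE
          set_mset_formal[of "X f"] set_mset_formal[of "tneg F (Z f)"] by auto
      ultimately show ?thesis by argo
    qed
  qed
  moreover have "\<forall>i<k. Z (e i) = None" using Z_None D(4) eE by blast
  ultimately show ?thesis using Z(1) by blast
qed

end

text \<open>Strong relations hold for every pair of subsets, so any basis containing
  \<open>supp E X - {g}\<close> may serve as \<open>zs\<close> in
  \<open>null_sum_of_relation\<close>, whatever \<open>f # T\<close> is.\<close>

lemma strong_elimination:
  assumes gp: "gp_function F E r \<phi>"
  shows "strong_modular_elimination F E \<C>"
  unfolding strong_modular_elimination_def
proof (intro allI impI, elim conjE)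
  fix k Xs X e
  assume len: "length Xs = k" and fam: "modular_family E \<C> (Suc k) (Xs @ [X])"
    and nsub: "\<not> supp E X \<subseteq> (\<Union>i<k. supp E (Xs ! i))"
    and e: "\<forall>i<k. e i \<in> (supp E X \<inter> supp E (Xs ! i)) - (\<Union>j\<in>{..<k} - {i}. supp E (Xs ! j)) \<and>
               X (e i) = tneg F ((Xs ! i) (e i)) \<and> X (e i) \<noteq> None"
  obtain g where g: "g \<in> supp E X" and "g \<notin> (\<Union>i<k. supp E (Xs ! i))"
    using nsub by (meson subsetI)
  then have g': "g \<notin> supp E (Xs ! i)" if "i < k" for i using that by simp
  have X: "X \<in> \<C>" using fam by (simp add: modular_family_def)
  obtain B where B: "B \<in> \<B>" "supp E X - {g} \<subseteq> B"
    using circuit_diff_indep[OF gp_circuit_supp[OF X] g] unfolding matroid_indep_def by blast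
  obtain zs where zs: "zs \<in> tuples E r" "\<phi> zs \<noteq> None" "set zs = B" "distinct zs"
    using B(1) by (rule basisE)
  show "\<exists>Z\<in>\<C>. (\<forall>i<k. Z (e i) = None) \<and>
      (\<forall>f\<in>E. (\<Sum>i<k. formal ((Xs ! i) f)) + formal (X f) + formal (tneg F (Z f)) \<in> nullset F)"
  proof (rule modular_elimination[OF len fam g g'])
    fix f T assume T: "f # T \<in> tuples E r" "\<phi> (f # T) \<noteq> None"
    have gB: "g \<notin> B"
      using circuit_not_in_basis[OF gp_circuit_supp[OF X] B(1)] B(2) by auto
    have gE: "g \<in> E" using g by (auto simp: supp_def)
    have "gp_relation F \<phi> (g # zs) T"
      using gp zs gB gE T phi_distinct[OF T] unfolding gp_function_def
      by (elim conjE) (auto simp: tuples_def)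
    then show "(\<Sum>x\<in>E. formal (tmult F (X x) (\<phi> (x # T)))) \<in> nullset F"
      using B(2) zs T gE by (intro null_sum_of_relation[OF X g _ zs(1,2)]) (auto simp: tuples_def)
  qed (use e in auto)
qed

text \<open>Exchanging some \<open>z \<in> supp(Y) - supp(X)\<close> for \<open>e\<close> in \<open>B\<close> gives a basis whose relation with
  \<open>B - f\<close> has three terms, and only two, those at \<open>e\<close> and \<open>g\<close>, if \<open>z = f\<close>.\<close>

lemma weak_elimination: "weak_modular_elimination F E \<C>"
  unfolding weak_modular_elimination_def
proof (intro allI ballI impI, elim conjE)
  fix X Y e
  assume eE: "e \<in> E" and pair: "modular_pair E \<C> X Y" and neg: "X e = tneg F (Y e)"
    and ne: "X e \<noteq> None"
  \<comment> \<open>The elimination lemma singles out the last member, so the pair is reversed;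
    neither the union nor distinctness depends on the order.\<close>
  have fam: "modular_family E \<C> (Suc 1) ([Y] @ [X])"
    using pair by (auto simp: modular_pair_def modular_family_def numeral_2_eq_2 Un_commute)
  have X: "X \<in> \<C>" and Y: "Y \<in> \<C>" and diff: "supp E X \<noteq> supp E Y"
    using pair by (auto simp: modular_pair_def modular_family_def)
  note cX = gp_circuit_supp[OF X] and cY = gp_circuit_supp[OF Y]
  have eX: "e \<in> supp E X" and eY: "e \<in> supp E Y"
    using eE ne ne[unfolded neg] by (simp_all add: supp_def)
  \<comment> \<open>Distinct circuits are incomparable, so each of the two supports has an element
    outside the other.\<close>
  obtain g where g: "g \<in> supp E X" "g \<notin> supp E Y"
    using circuit_minimal[OF cX cY] diff by blast
  obtain z where z: "z \<in> supp E Y" "z \<notin> supp E X"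
    using circuit_minimal[OF cY cX] diff by blast
  have gE: "g \<in> E" using g(1) by (auto simp: supp_def)
  have "\<exists>Z\<in>\<C>. (\<forall>i<(1::nat). Z e = None) \<and>
      (\<forall>f\<in>E. (\<Sum>i<1. formal (([Y] ! i) f)) + formal (X f) + formal (tneg F (Z f)) \<in> nullset F)"
  proof (rule modular_elimination[where e = "\<lambda>_. e", OF _ fam g(1)])
    fix B f T
    assume B: "B \<in> \<B>" "g \<notin> B" and X_B: "supp E X \<subseteq> insert g (B \<union> (\<lambda>_. e) ` {..<1})"
      and Y_B': "\<And>i. i < 1 \<Longrightarrow> e \<notin> B \<and> supp E ([Y] ! i) \<subseteq> insert e B"
      and T: "set (f # T) = B" "f # T \<in> tuples E r" "\<phi> (f # T) \<noteq> None"
    have eB: "e \<notin> B" and Y_B: "supp E Y \<subseteq> insert e B" using Y_B'[of 0] by auto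
    have ge: "g \<noteq> e" using g(2) eY by auto
    have d: "distinct (f # T)" by (rule phi_distinct[OF T(2,3)])
    have ze: "z \<noteq> e" using z eX by auto
    have zB: "z \<in> B" using z Y_B ze by auto
    have tup: "x # T \<in> tuples E r" if "x \<in> E" for x using that T(2) by (auto simp: tuples_def)
    have B': "insert e (B - {z}) \<in> \<B>" by (rule circuit_swap[OF cY B(1) Y_B z(1) ze])
    show "(\<Sum>x\<in>E. formal (tmult F (X x) (\<phi> (x # T)))) \<in> nullset F"
    proof (cases "z = f")
      case False
      obtain zs where zs: "zs \<in> tuples E r" "\<phi> zs \<noteq> None" "set zs = insert e (B - {z})" "distinct zs"
        using B' by (rule basisE)
      have "set (g # zs) - set T = {e, f, g}"
        using zs(3) T(1) d False zB eB B(2) by auto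
      moreover have "e \<noteq> f" "f \<noteq> g" using T(1) eB B(2) by auto
      ultimately have card: "card (set (g # zs) - set T) = 3" using ge by simp
      have "gp_relation F \<phi> (g # zs) T"
        by (rule three_term_relation)
          (use zs B(2) ge gE T(2) d card in \<open>auto simp: tuples_def\<close>)
      then show ?thesis
        using X_B z zs(3) by (intro null_sum_of_relation[OF X g(1) _ zs(1,2) tup[OF gE]]) auto
    next
      case True
      let ?h = "\<lambda>x. tmult F (X x) (\<phi> (x # T))"
      have "set (e # T) = insert e (B - {z})" "distinct (e # T)" using True T(1) d eB by auto
      then have eT: "\<phi> (e # T) \<noteq> None" using phi_basis_iff[OF tup[OF eE]] B' by simp
      \<comment> \<open>As \<open>z = f\<close> is outside \<open>supp E X\<close>, the support lies
        in \<open>g\<close>, \<open>e\<close> and \<open>T\<close>, and the circuit relation of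
        \<open>X\<close> at \<open>g\<close> and \<open>e\<close> alone makes the sum null.\<close>
      have "supp E X \<subseteq> insert g (insert e (set T))" using X_B z True T(1) by auto
      then have h: "?h g = tneg F (?h e)"
        using gp_circuit_orthogonal[OF X gE tup[OF eE] eT] by blast
      have "?h x = None" if "x \<in> E - {e, g}" for x
      proof (cases "x \<in> supp E X")
        case x: True
        then have "x \<in> set T" using that X_B z True T(1) by auto
        then show ?thesis using phi_not_distinct[OF tup[of x]] that by simp
      qed (use that in \<open>auto simp: supp_def\<close>)
      then have "(\<Sum>x\<in>E. formal (?h x)) = (\<Sum>x\<in>{e, g}. formal (?h x))"
        using eE gE by (intro sum.mono_neutral_right) (auto simp: finite_E)
      also have "\<dots> = formal (?h e) + formal (?h g)" using ge by simp
      also have "\<dots> \<in> nullset F"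
        using h gp_circuit_closed[OF X] eE gE tup by (subst null_pair_iff) auto
      finally show ?thesis .
    qed
  qed (use eX eY g neg in auto)
  then show "\<exists>Z\<in>\<C>. Z e = None \<and>
      (\<forall>f\<in>E. formal (X f) + formal (Y f) + formal (tneg F (Z f)) \<in> nullset F)"
    by (simp add: add.commute)
qed

end

theorem theorem4p10:
  fixes F :: "('g, 'm) tract_scheme"
    and E :: "'e set"
    and r :: nat
    and \<phi> :: "'e list \<Rightarrow> 'g option"
  assumes "tract F"
    and "finite E"
  shows "(gp_function F E r \<phi> \<longrightarrow> strong_modular_elimination F E (gp_circuits F E r \<phi>)) \<and>
         (weak_gp_function F E r \<phi> \<longrightarrow> weak_modular_elimination F E (gp_circuits F E r \<phi>))"
proof (intro conjI impI)
  assume gp: "gp_function F E r \<phi>"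
  have closed: "\<phi> \<in> tuples E r \<rightarrow> tract_elems F" and alt: "alternating F E r \<phi>"
    using gp by (simp_all only: gp_function_def)
  have "alternating_function F E r \<phi>"
    by (rule alternating_function.intro[OF assms(1)
          alternating_function_axioms.intro[OF closed alt assms(2)]])
  then have "weak_gp F E r \<phi>"
    by (intro weak_gp.intro weak_gp_axioms.intro alternating_function.gp_function_imp_weak gp)
  then show "strong_modular_elimination F E (gp_circuits F E r \<phi>)"
    by (rule weak_gp.strong_elimination[OF _ gp])
next
  assume weak: "weak_gp_function F E r \<phi>"
  have closed: "\<phi> \<in> tuples E r \<rightarrow> tract_elems F" and alt: "alternating F E r \<phi>"
    using weak by (simp_all only: weak_gp_function_def)
  have "alternating_function F E r \<phi>"
    by (rule alternating_function.intro[OF assms(1)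
          alternating_function_axioms.intro[OF closed alt assms(2)]])
  then have "weak_gp F E r \<phi>"
    by (intro weak_gp.intro weak_gp_axioms.intro weak)
  then show "weak_modular_elimination F E (gp_circuits F E r \<phi>)"
    by (rule weak_gp.weak_elimination)
qed

end
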